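(* Let $\Bbbk$ be a field of characteristic $0$, $V$ an $n$-dimensional $\Bbbk$-vector space, and let $U\subset\mathrm{Alg}(V)$ be the open separable locus. For $x\in U$, the Zariski tangent space satisfies $$T_x\mathrm{Alg}(V)\cong Z^2(V_x,V_x)$$ and $$\dim_\Bbbk T_x\mathrm{Alg}(V)=n^2-\dim_\Bbbk\mathrm{Der}_\Bbbk(V_x)=n^2-n+\dim_\Bbbk Z(V_x).$$ When $\Bbbk$ is algebraically closed and $V_x\cong\bigoplus_{s=1}^k M_{r_s}(\Bbbk)$ with $\sum_s r_s^2=n$, this dimension is equal to $n^2-n+k$.
   Context: Fix a basis $(e_i)_{i=1}^n$ of $V$. $V^{2,1}=\mathrm{Hom}(V\otimes V,V)\cong\Bbbk^{n^3}$; each $x\in V^{2,1}$ has structure constants $x_{i,j}^\ell$ and determines the product $\mu_x(e_i,e_j)=\sum_\ell x_{i,j}^\ell e_\ell$; $V_x=(V,\mu_x)$. $\mathrm{Alg}(V)$ is the closed subscheme of $V^{2,1}$ of associative products, cut out by the $n^4$ quadratic polynomials $\sum_{\ell}x_{i,j}^{\ell}x_{\ell,k}^m-\sum_{\ell}x_{i,\ell}^m x_{j,k}^{\ell}$. For $x\in\mathrm{Alg}(V)$ the principal trace form is $T_x(a,b)=\mathrm{Tr}(L_{ab})$, where $L_z$ is left multiplication by $z$ in $V_x$; $D_x=(\mathrm{Tr}(L_{e_ie_j}))_{i,j}$ is its Gram matrix and $\Delta(x)=\det D_x$. The separable locus is $U=\{x\in\mathrm{Alg}(V):\Delta(x)\neq0\}$;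 it consists precisely of the separable (equivalently, in characteristic $0$, semisimple) algebras. $Z^2(V_x,V_x)$ is the space of Hochschild $2$-cocycles of $V_x$ with coefficients in itself, $\mathrm{Der}_\Bbbk(V_x)$ the space of $\Bbbk$-linear derivations, and $Z(V_x)$ the center of $V_x$. *)

theory Defs
  imports
    "HOL-Library.Poly_Mapping"
    "HOL-Library.Function_Algebras"
    "HOL-Library.FuncSet"
    "HOL-Computational_Algebra.Polynomial"
    "Jordan_Normal_Form.Determinant"
begin

text \<open>
  The vector space \<open>V\<close> is the whole type \<open>'v\<close> with scalar multiplication \<open>scale\<close>; its fixed basis
  is \<open>e 0, \<dots>, e (n - 1)\<close>, indexed from 0, and \<open>n = 0\<close> is allowed.
\<close>

definition indexed_basis :: "('k::field \<Rightarrow> 'v::ab_group_add \<Rightarrow> 'v) \<Rightarrow> (nat \<Rightarrow> 'v) \<Rightarrow> nat \<Rightarrow> bool" where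
  "indexed_basis scale e n \<longleftrightarrow>
     inj_on e {..<n} \<and>
     \<not> Modules.module.dependent scale (e ` {..<n}) \<and>
     Modules.module.span scale (e ` {..<n}) = UNIV"

definition coord :: "('k::field \<Rightarrow> 'v::ab_group_add \<Rightarrow> 'v) \<Rightarrow> (nat \<Rightarrow> 'v) \<Rightarrow> nat \<Rightarrow> 'v \<Rightarrow> nat \<Rightarrow> 'k" where
  "coord scale e n v i = Modules.module.representation scale (e ` {..<n}) v (e i)"

definition endo_trace :: "('k::field \<Rightarrow> 'v::ab_group_add \<Rightarrow> 'v) \<Rightarrow> (nat \<Rightarrow> 'v) \<Rightarrow> nat \<Rightarrow> ('v \<Rightarrow> 'v) \<Rightarrow> 'k" where
  "endo_trace scale e n f = (\<Sum>i<n. coord scale e n (f (e i)) i)"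

subsection \<open>The scheme of associative products\<close>

text \<open>
  The coordinate of \<open>V\<^sup>2\<^sup>,\<^sup>1\<close> whose value is the structure constant \<open>x\<^sub>i\<^sub>,\<^sub>j\<^sup>l\<close> is indexed by \<open>(i, j, l)\<close>.
  A point of \<open>V\<^sup>2\<^sup>,\<^sup>1\<close> is a function on such triples; its values outside \<open>sc_index n\<close> are irrelevant.
\<close>

type_synonym sc_var = "nat \<times> nat \<times> nat"
type_synonym 'k sc_poly = "(sc_var \<Rightarrow>\<^sub>0 nat) \<Rightarrow>\<^sub>0 'k"

definition sc_index :: "nat \<Rightarrow> sc_var set" where
  "sc_index n = {..<n} \<times> {..<n} \<times> {..<n}"

definition product_of :: "('k::field \<Rightarrow> 'v::ab_group_add \<Rightarrow> 'v) \<Rightarrow> (nat \<Rightarrow> 'v) \<Rightarrow> nat \<Rightarrow> (sc_var \<Rightarrow> 'k) \<Rightarrow>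
    'v \<Rightarrow> 'v \<Rightarrow> 'v" where
  "product_of scale e n x a b =
     (\<Sum>i<n. \<Sum>j<n. \<Sum>l<n. scale (coord scale e n a i * coord scale e n b j * x (i, j, l)) (e l))"

text \<open>
  Multivariate polynomials are elements of the monoid algebra of finitely supported exponent
  functions; \<open>sc_ring n\<close> is the polynomial ring in the \<open>n\<^sup>3\<close> variables indexed by \<open>sc_index n\<close>.
\<close>

definition sc_ring :: "nat \<Rightarrow> 'k::field sc_poly set" where
  "sc_ring n = {p. \<forall>m\<in>Poly_Mapping.keys p. Poly_Mapping.keys m \<subseteq> sc_index n}"

definition pconst :: "'k::field \<Rightarrow> 'k sc_poly" where
  "pconst c = Poly_Mapping.single 0 c"

definition pvar :: "sc_var \<Rightarrow> 'k::field sc_poly" where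
  "pvar v = Poly_Mapping.single (Poly_Mapping.single v 1) 1"

definition peval :: "(sc_var \<Rightarrow> 'k::field) \<Rightarrow> 'k sc_poly \<Rightarrow> 'k" where
  "peval x p = (\<Sum>m\<in>Poly_Mapping.keys p.
     Poly_Mapping.lookup p m * (\<Prod>v\<in>Poly_Mapping.keys m. x v ^ Poly_Mapping.lookup m v))"

definition assoc_poly :: "nat \<Rightarrow> nat \<Rightarrow> nat \<Rightarrow> nat \<Rightarrow> nat \<Rightarrow> 'k::field sc_poly" where
  "assoc_poly n i j k m =
     (\<Sum>l<n. pvar (i, j, l) * pvar (l, k, m)) - (\<Sum>l<n. pvar (i, l, m) * pvar (j, k, l))"

definition assoc_ideal :: "nat \<Rightarrow> 'k::field sc_poly set" where
  "assoc_ideal n = {\<Sum>i<n. \<Sum>j<n. \<Sum>k<n. \<Sum>m<n. g i j k m * assoc_poly n i j k m | g.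
     \<forall>i<n. \<forall>j<n. \<forall>k<n. \<forall>m<n. g i j k m \<in> sc_ring n}"

text \<open>The \<open>\<k>\<close>-rational points of the closed subscheme \<open>Alg(V)\<close>, for \<open>\<k>\<close> the ground field.\<close>

definition Alg :: "nat \<Rightarrow> (sc_var \<Rightarrow> 'k::field) set" where
  "Alg n = {x. \<forall>p\<in>assoc_ideal n. peval x p = 0}"

definition discr :: "('k::field \<Rightarrow> 'v::ab_group_add \<Rightarrow> 'v) \<Rightarrow> (nat \<Rightarrow> 'v) \<Rightarrow> nat \<Rightarrow> (sc_var \<Rightarrow> 'k) \<Rightarrow> 'k" where
  "discr scale e n x =
     (let \<mu> = product_of scale e n x;
          T = (\<lambda>a b. endo_trace scale e n (\<lambda>c. \<mu> (\<mu> a b) c))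
      in det (mat n n (\<lambda>(i, j). T (e i) (e j))))"

definition separable_locus :: "('k::field \<Rightarrow> 'v::ab_group_add \<Rightarrow> 'v) \<Rightarrow> (nat \<Rightarrow> 'v) \<Rightarrow> nat \<Rightarrow>
    (sc_var \<Rightarrow> 'k) set" where
  "separable_locus scale e n = {x \<in> Alg n. discr scale e n x \<noteq> 0}"

subsection \<open>The Zariski tangent space\<close>

definition point_ideal :: "nat \<Rightarrow> (sc_var \<Rightarrow> 'k::field) \<Rightarrow> 'k sc_poly set" where
  "point_ideal n x = {p \<in> sc_ring n. peval x p = 0}"

definition ideal_square :: "'k::field sc_poly set \<Rightarrow> 'k sc_poly set" where
  "ideal_square M = {\<Sum>t<N. a t * b t | (N::nat) a b. \<forall>t<N. a t \<in> M \<and> b t \<in> M}"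

text \<open>
  The dual space of \<open>\<mm>/\<mm>\<^sup>2\<close>, where \<open>\<mm> = M/I\<close> is the maximal ideal of the point \<open>x\<close> in the coordinate
  ring \<open>\<k>[X]/I\<close> of \<open>Alg(V)\<close>, with \<open>M = point_ideal n x\<close> and \<open>I = assoc_ideal n\<close> (passing to the local
  ring does not change \<open>\<mm>/\<mm>\<^sup>2\<close>). A functional on \<open>\<mm>/\<mm>\<^sup>2 = M/(M\<^sup>2 + I)\<close> is given as a linear functional
  on \<open>M\<close> vanishing on \<open>M\<^sup>2\<close> and on \<open>I\<close>. It is extended by 0 outside \<open>M\<close>, so that distinct members of
  the set below are distinct functionals on \<open>M\<close>. The definition is meant for \<open>x \<in> Alg n\<close>, where
  \<open>I \<subseteq> M\<close>.
\<close>

definition tangent_space :: "nat \<Rightarrow> (sc_var \<Rightarrow> 'k::field) \<Rightarrow> ('k sc_poly \<Rightarrow> 'k) set" where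
  "tangent_space n x = {\<phi>.
     (\<forall>p\<in>point_ideal n x. \<forall>q\<in>point_ideal n x. \<phi> (p + q) = \<phi> p + \<phi> q) \<and>
     (\<forall>c. \<forall>p\<in>point_ideal n x. \<phi> (pconst c * p) = c * \<phi> p) \<and>
     (\<forall>p\<in>ideal_square (point_ideal n x). \<phi> p = 0) \<and>
     (\<forall>p\<in>assoc_ideal n. \<phi> p = 0) \<and>
     (\<forall>p. p \<notin> point_ideal n x \<longrightarrow> \<phi> p = 0)}"

subsection \<open>Cocycles, derivations, centre\<close>

definition hochschild_Z2 :: "('k::field \<Rightarrow> 'v::ab_group_add \<Rightarrow> 'v) \<Rightarrow> ('v \<Rightarrow> 'v \<Rightarrow> 'v) \<Rightarrow>
    ('v \<Rightarrow> 'v \<Rightarrow> 'v) set" where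
  "hochschild_Z2 scale \<mu> = {f.
     (\<forall>a. Vector_Spaces.linear scale scale (\<lambda>b. f a b)) \<and>
     (\<forall>b. Vector_Spaces.linear scale scale (\<lambda>a. f a b)) \<and>
     (\<forall>a b c. \<mu> a (f b c) - f (\<mu> a b) c + f a (\<mu> b c) - \<mu> (f a b) c = 0)}"

definition derivations :: "('k::field \<Rightarrow> 'v::ab_group_add \<Rightarrow> 'v) \<Rightarrow> ('v \<Rightarrow> 'v \<Rightarrow> 'v) \<Rightarrow> ('v \<Rightarrow> 'v) set" where
  "derivations scale \<mu> = {D.
     Vector_Spaces.linear scale scale D \<and> (\<forall>a b. D (\<mu> a b) = \<mu> (D a) b + \<mu> a (D b))}"

definition centre :: "('v \<Rightarrow> 'v \<Rightarrow> 'v) \<Rightarrow> 'v set" where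
  "centre \<mu> = {z. \<forall>a. \<mu> z a = \<mu> a z}"

subsection \<open>Linear structure on spaces of maps, isomorphisms\<close>

definition scale1 :: "('k \<Rightarrow> 'v \<Rightarrow> 'v) \<Rightarrow> 'k \<Rightarrow> ('a \<Rightarrow> 'v) \<Rightarrow> ('a \<Rightarrow> 'v)" where
  "scale1 scale c f = (\<lambda>a. scale c (f a))"

definition scale2 :: "('k \<Rightarrow> 'v \<Rightarrow> 'v) \<Rightarrow> 'k \<Rightarrow> ('a \<Rightarrow> 'b \<Rightarrow> 'v) \<Rightarrow> ('a \<Rightarrow> 'b \<Rightarrow> 'v)" where
  "scale2 scale c f = (\<lambda>a b. scale c (f a b))"

definition lin_isomorphic :: "('k \<Rightarrow> 'a::ab_group_add \<Rightarrow> 'a) \<Rightarrow> 'a set \<Rightarrow>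
    ('k \<Rightarrow> 'b::ab_group_add \<Rightarrow> 'b) \<Rightarrow> 'b set \<Rightarrow> bool" where
  "lin_isomorphic s1 S s2 T \<longleftrightarrow> (\<exists>F. bij_betw F S T \<and>
     (\<forall>u\<in>S. \<forall>v\<in>S. F (u + v) = F u + F v) \<and> (\<forall>c. \<forall>u\<in>S. F (s1 c u) = s2 c (F u)))"

text \<open>
  \<open>V\<close> with the product \<open>\<mu>\<close> is isomorphic, as an algebra, to the direct sum of the matrix algebras of
  sizes \<open>r 0, \<dots>, r (k - 1)\<close>; an element of the direct sum is a family indexed by \<open>{..<k}\<close>.
\<close>

definition iso_matrix_sum :: "('k::field \<Rightarrow> 'v::ab_group_add \<Rightarrow> 'v) \<Rightarrow> ('v \<Rightarrow> 'v \<Rightarrow> 'v) \<Rightarrow> nat \<Rightarrow>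
    (nat \<Rightarrow> nat) \<Rightarrow> bool" where
  "iso_matrix_sum scale \<mu> k r \<longleftrightarrow> (\<exists>F :: 'v \<Rightarrow> nat \<Rightarrow> 'k mat.
     bij_betw F UNIV (\<Pi>\<^sub>E s\<in>{..<k}. carrier_mat (r s) (r s)) \<and>
     (\<forall>a b. \<forall>s<k. F (a + b) s = F a s + F b s) \<and>
     (\<forall>c a. \<forall>s<k. F (scale c a) s = c \<cdot>\<^sub>m F a s) \<and>
     (\<forall>a b. \<forall>s<k. F (\<mu> a b) s = F a s * F b s))"

text \<open>
  A statement about the type \<open>'k\<close> instead of the type class \<open>alg_closed_field\<close>, because only part of
  the theorem assumes it.
\<close>

definition algebraically_closed_field :: "'k::field itself \<Rightarrow> bool" where
  "algebraically_closed_field _ \<longleftrightarrow> (\<forall>p :: 'k poly. 0 < degree p \<longrightarrow> (\<exists>z. poly p z = 0))"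

end

theory Submission
  imports Defs
begin

text \<open>
  A tangent vector at \<open>x\<close> is a direction \<open>d\<close> in which all the derivatives of the associativity
  equations vanish, and these equations are, up to sign, the coordinates of the cocycle condition
  for the bilinear map with structure constants \<open>d\<close>. For the rest, let \<open>e\<^sup>i\<close> be the basis dual to
  \<open>e\<^sub>i\<close> for the trace form. The element \<open>\<Sum> e\<^sub>i \<otimes> e\<^sup>i\<close> is a separability idempotent, so
  \<open>g a = \<Sum> e\<^sub>i f(e\<^sup>i, a)\<close> has coboundary \<open>f\<close> for every 2-cocycle \<open>f\<close>, and
  \<open>d = \<Sum> e\<^sub>i D(e\<^sup>i)\<close> satisfies \<open>D a = a d - d a\<close> for every derivation \<open>D\<close>. Rank-nullity for the
  coboundary map on \<open>End V\<close> and for \<open>d \<mapsto> (a \<mapsto> a d - d a)\<close> on \<open>V\<close> gives both dimension formulas.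
\<close>

subsection \<open>Dimensions\<close>

text \<open>A basis of \<open>S\<close> is carried to a basis of the image. The statement is about a
  subspace because the spaces to be compared sit inside large function types.\<close>

lemma dim_image_inj_on:
  assumes f: "Vector_Spaces.linear s1 s2 f"
    and S: "module.subspace s1 S" and inj: "inj_on f S"
  shows "vector_space.dim s2 (f ` S) = vector_space.dim s1 S"
proof -
  interpret f: Vector_Spaces.linear s1 s2 f by (rule f)
  obtain B where B: "B \<subseteq> S" "f.vs1.independent B" "S \<subseteq> f.vs1.span B" "card B = f.vs1.dim S"
    by (rule f.vs1.basis_exists)
  have span: "f.vs1.span B = S"
    using B(1,3) S by (simp add: f.vs1.span_minimal subset_antisym)
  show ?thesis
  proof (rule f.vs2.dim_unique)
    show "f ` B \<subseteq> f ` S" using B(1) by (rule image_mono)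
    show "f ` S \<subseteq> f.vs2.span (f ` B)" by (simp add: f.span_image span)
    show "f.vs2.independent (f ` B)"
      by (rule f.independent_injective_image[OF B(2)]) (simp add: span inj)
    show "card (f ` B) = f.vs1.dim S"
      using B(4) card_image[OF inj_on_subset[OF inj B(1)]] by simp
  qed
qed

text \<open>Rank-nullity relative to a subspace: a basis \<open>A\<close> of the kernel is extended
  to a basis \<open>B\<close> of \<open>S\<close>, and \<open>f\<close> sends \<open>B - A\<close>
  to a basis of the image. The finite set \<open>C\<close> bounds \<open>B\<close>, so that
  cardinalities may be subtracted.\<close>

lemma dim_kernel_add_dim_image:
  assumes f: "Vector_Spaces.linear s1 s2 f"
    and S: "module.subspace s1 S" and C: "finite C" "S \<subseteq> module.span s1 C"
  shows "vector_space.dim s1 S = vector_space.dim s1 {x \<in> S. f x = 0} + vector_space.dim s2 (f ` S)"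
proof -
  interpret f: Vector_Spaces.linear s1 s2 f by (rule f)
  define K where "K = {x \<in> S. f x = 0}"
  obtain A where A: "A \<subseteq> K" "f.vs1.independent A" "K \<subseteq> f.vs1.span A"
    by (rule f.vs1.basis_exists)
  have "A \<subseteq> S" using A(1) by (auto simp: K_def)
  then obtain B where B: "A \<subseteq> B" "B \<subseteq> S" "f.vs1.independent B" "S \<subseteq> f.vs1.span B"
    using f.vs1.maximal_independent_subset_extend[OF _ A(2)] by metis
  have "B \<subseteq> f.vs1.span C" using B(2) C(2) by blast
  then have finB: "finite B"
    using f.vs1.independent_span_bound[OF C(1) B(3)] by blast
  have indep: "f.vs1.independent (B - A)"
    by (rule f.vs1.independent_mono[OF B(3)]) auto
  \<comment> \<open>A vector of this span killed by \<open>f\<close> also lies in the span of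
    \<open>A\<close>. Its coordinates with respect to \<open>B\<close> are then supported on two
    disjoint sets, so they all vanish.\<close>
  have inj: "inj_on f (f.vs1.span (B - A))"
    unfolding f.inj_on_iff_eq_0[OF f.vs1.subspace_span]
  proof (intro ballI impI)
    fix x assume x: "x \<in> f.vs1.span (B - A)" and fx: "f x = 0"
    have xS: "x \<in> S"
      using x f.vs1.span_minimal[of "B - A" S] B(2) S by blast
    then have "x \<in> f.vs1.span A" using fx A(3) by (auto simp: K_def)
    then have "f.vs1.representation B x = f.vs1.representation A x"
      using f.vs1.representation_extend B(1,3) by blast
    moreover have "f.vs1.representation B x = f.vs1.representation (B - A) x"
      using f.vs1.representation_extend[OF B(3) x] by auto
    ultimately have "f.vs1.representation B x b = 0" for b
      using f.vs1.representation_ne_zero[of A x b] f.vs1.representation_ne_zero[of "B - A" x b]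
      by auto
    moreover have "(\<Sum>b | f.vs1.representation B x b \<noteq> 0. s1 (f.vs1.representation B x b) b) = x"
      using f.vs1.sum_nonzero_representation_eq[OF B(3)] xS B(4) by blast
    ultimately show "x = 0" by simp
  qed
  have "f ` B \<subseteq> insert 0 (f ` (B - A))"
    using A(1) by (auto simp: K_def)
  then have "f.vs2.span (f ` B) \<subseteq> f.vs2.span (f ` (B - A))"
    by (metis f.vs2.span_insert_0 f.vs2.span_mono)
  then have "f ` S \<subseteq> f.vs2.span (f ` (B - A))"
    using f.spans_image[OF B(4)] by blast
  moreover have "card (f ` (B - A)) = card B - card A"
    using card_image[OF inj_on_subset[OF inj f.vs1.span_superset]] finB B(1)
    by (simp add: card_Diff_subset finite_subset)
  ultimately have "f.vs2.dim (f ` S) = card B - card A"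
    using B(2) by (intro f.vs2.dim_unique[of "f ` (B - A)"] f.independent_injective_image indep inj) auto
  moreover have "f.vs1.dim S = card B" "f.vs1.dim K = card A"
    using A B by (metis f.vs1.basis_card_eq_dim)+
  ultimately show ?thesis
    using card_mono[OF finB B(1)] by (simp add: K_def)
qed

section \<open>Pointwise linear structure on function spaces\<close>

lemma vector_space_scale1: "vector_space scale \<Longrightarrow> vector_space (scale1 scale)"
  by (auto simp: vector_space_def scale1_def fun_eq_iff)

lemma scale2_eq_scale1: "scale2 scale = scale1 (scale1 scale)"
  by (simp add: fun_eq_iff scale1_def scale2_def)

lemma vector_space_scale2: "vector_space scale \<Longrightarrow> vector_space (scale2 scale)"
  by (simp add: scale2_eq_scale1 vector_space_scale1)

lemma vector_space_times: "vector_space ((*) :: 'k::field \<Rightarrow> 'k \<Rightarrow> 'k)"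
  by (simp add: vector_space_def algebra_simps)

lemma sum_apply: "(\<Sum>i\<in>A. f i) x = (\<Sum>i\<in>A. f i x)"
  by (induction A rule: infinite_finite_induct) auto

text \<open>The unit vectors at the points of \<open>I\<close> form a basis. This is the coordinate
  model against which the endomorphisms of V and the centre of a sum of matrix algebras are
  measured.\<close>

lemma dim_functions_supported_on:
  fixes I :: "'i set"
  assumes I: "finite I"
  shows "vector_space.dim (scale1 (*)) {c :: 'i \<Rightarrow> 'k::field. \<forall>i. i \<notin> I \<longrightarrow> c i = 0} = card I"
proof -
  interpret vector_space "scale1 ((*) :: 'k \<Rightarrow> 'k \<Rightarrow> 'k) :: 'k \<Rightarrow> ('i \<Rightarrow> 'k) \<Rightarrow> 'i \<Rightarrow> 'k"
    by (intro vector_space_scale1 vector_space_times)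
  define u where "u i = (\<lambda>j. if j = i then 1 else 0 :: 'k)" for i :: 'i
  have inj: "inj u" by (auto simp: u_def fun_eq_iff intro!: injI split: if_splits)
  show ?thesis
  proof (rule dim_unique[of "u ` I"])
    show "u ` I \<subseteq> {c. \<forall>i. i \<notin> I \<longrightarrow> c i = 0}" by (auto simp: u_def)
    show "card (u ` I) = card I" using inj by (simp add: card_image inj_on_subset)
    show "{c. \<forall>i. i \<notin> I \<longrightarrow> c i = 0} \<subseteq> span (u ` I)"
    proof
      fix c :: "'i \<Rightarrow> 'k" assume "c \<in> {c. \<forall>i. i \<notin> I \<longrightarrow> c i = 0}"
      then have "c = (\<Sum>i\<in>I. scale1 (*) (c i) (u i))"
        using I by (auto simp: fun_eq_iff sum_apply scale1_def u_def if_distrib[of "(*) _"] cong: if_cong)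
      also have "\<dots> \<in> span (u ` I)"
        by (intro span_sum span_scale span_base imageI)
      finally show "c \<in> span (u ` I)" .
    qed
    show "independent (u ` I)"
    proof (rule independent_if_scalars_zero)
      show "finite (u ` I)" using I by simp
      fix g v assume g: "(\<Sum>v\<in>u ` I. scale1 (*) (g v) v) = 0" and "v \<in> u ` I"
      then obtain i where i: "i \<in> I" "v = u i" by auto
      have "(\<Sum>j\<in>I. scale1 (*) (g (u j)) (u j)) = 0"
        using g inj by (simp add: sum.reindex inj_on_subset)
      then have "(\<Sum>j\<in>I. scale1 (*) (g (u j)) (u j)) i = 0" by simp
      then show "g v = 0"
        using I i by (simp add: sum_apply scale1_def u_def if_distrib[of "(*) _"] cong: if_cong)
    qed
  qed
qed

subsection \<open>Evaluation and directional derivatives of polynomials\<close>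

text \<open>Evaluation in a ring that may differ from the coefficient ring: with \<open>h\<close>
  the identity it is \<open>peval\<close>, and with \<open>h\<close> the embedding of constants into
  \<open>'k poly\<close> it restricts a polynomial to a line through a point.\<close>

definition eval_poly_mapping :: "('k::comm_ring_1 \<Rightarrow> 'a::comm_ring_1) \<Rightarrow> ('i \<Rightarrow> 'a) \<Rightarrow>
    (('i \<Rightarrow>\<^sub>0 nat) \<Rightarrow>\<^sub>0 'k) \<Rightarrow> 'a" where
  "eval_poly_mapping h y p = (\<Sum>m\<in>Poly_Mapping.keys p.
     h (Poly_Mapping.lookup p m) * (\<Prod>v\<in>Poly_Mapping.keys m. y v ^ Poly_Mapping.lookup m v))"

text \<open>All three products may be taken over the union of the two supports, since the added
  factors are zeroth powers.\<close>

lemma monomial_eval_add: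
  fixes y :: "'i \<Rightarrow> 'a::comm_ring_1" and m m' :: "'i \<Rightarrow>\<^sub>0 nat"
  shows "(\<Prod>v\<in>Poly_Mapping.keys (m + m'). y v ^ Poly_Mapping.lookup (m + m') v) =
    (\<Prod>v\<in>Poly_Mapping.keys m. y v ^ Poly_Mapping.lookup m v) *
    (\<Prod>v\<in>Poly_Mapping.keys m'. y v ^ Poly_Mapping.lookup m' v)"
proof -
  let ?U = "Poly_Mapping.keys m \<union> Poly_Mapping.keys m'"
  have *: "(\<Prod>v\<in>Poly_Mapping.keys l. y v ^ Poly_Mapping.lookup l v) = (\<Prod>v\<in>?U. y v ^ Poly_Mapping.lookup l v)"
    if "Poly_Mapping.keys l \<subseteq> ?U" for l
    using that by (intro prod.mono_neutral_left) (auto simp: in_keys_iff)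
  have "(\<Prod>v\<in>?U. y v ^ Poly_Mapping.lookup (m + m') v) =
      (\<Prod>v\<in>?U. y v ^ Poly_Mapping.lookup m v) * (\<Prod>v\<in>?U. y v ^ Poly_Mapping.lookup m' v)"
    by (simp add: lookup_add power_add prod.distrib)
  then show ?thesis
    using *[OF Poly_Mapping.keys_add] *[of m] *[of m'] by simp
qed

lemma poly_mapping_sum_single:
  "(\<Sum>m\<in>Poly_Mapping.keys p. Poly_Mapping.single m (Poly_Mapping.lookup p m)) = p"
  by (rule poly_mapping_eqI)
    (auto simp: lookup_sum lookup_single when_def in_keys_iff)

locale coefficient_hom =
  fixes h :: "'k::comm_ring_1 \<Rightarrow> 'a::comm_ring_1"
  assumes hom_0: "h 0 = 0"
    and hom_add: "h (a + b) = h a + h b" and hom_mult: "h (a * b) = h a * h b"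
begin

lemma eval_zero: "eval_poly_mapping h y 0 = 0"
  by (simp add: eval_poly_mapping_def hom_0)

lemma eval_add: "eval_poly_mapping h y (p + q) = eval_poly_mapping h y p + eval_poly_mapping h y q"
  unfolding eval_poly_mapping_def
  by (rule setsum_keys_plus_distrib) (auto simp: hom_0 hom_add distrib_right)

lemma eval_sum: "eval_poly_mapping h y (\<Sum>i\<in>A. f i) = (\<Sum>i\<in>A. eval_poly_mapping h y (f i))"
  by (induction A rule: infinite_finite_induct) (auto simp: eval_add eval_zero)

lemma eval_diff: "eval_poly_mapping h y (p - q) = eval_poly_mapping h y p - eval_poly_mapping h y q"
  using eval_add[of y "p - q" q] by simp

lemma eval_single: "eval_poly_mapping h y (Poly_Mapping.single m c) =
    h c * (\<Prod>v\<in>Poly_Mapping.keys m. y v ^ Poly_Mapping.lookup m v)"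
  by (simp add: eval_poly_mapping_def hom_0)

text \<open>Both factors are written as sums of monomials, where multiplicativity is
  \<open>monomial_eval_add\<close>.\<close>

lemma eval_mult: "eval_poly_mapping h y (p * q) = eval_poly_mapping h y p * eval_poly_mapping h y q"
proof -
  let ?s = "\<lambda>p m. Poly_Mapping.single m (Poly_Mapping.lookup p m)"
  have "eval_poly_mapping h y (p * q) =
    eval_poly_mapping h y ((\<Sum>m\<in>Poly_Mapping.keys p. ?s p m) * (\<Sum>l\<in>Poly_Mapping.keys q. ?s q l))"
    by (simp only: poly_mapping_sum_single)
  also have "\<dots> = (\<Sum>m\<in>Poly_Mapping.keys p. eval_poly_mapping h y (?s p m)) *
      (\<Sum>l\<in>Poly_Mapping.keys q. eval_poly_mapping h y (?s q l))"
    unfolding sum_product eval_sum mult_single eval_single hom_mult monomial_eval_add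
    by (intro sum.cong refl) (simp only: mult_ac)
  also have "\<dots> = eval_poly_mapping h y p * eval_poly_mapping h y q"
    by (simp only: eval_single) (simp add: eval_poly_mapping_def)
  finally show ?thesis .
qed

end

interpretation eval_id: coefficient_hom "\<lambda>c :: 'k::field. c"
  by (rule coefficient_hom.intro) auto

lemma peval_eq_eval_poly_mapping: "peval = eval_poly_mapping (\<lambda>c. c)"
  by (intro ext) (simp only: eval_poly_mapping_def peval_def)

lemma peval_zero [simp]: "peval x 0 = 0"
  by (simp add: peval_def)

lemma peval_add: "peval x (p + q) = peval x p + peval x q"
  unfolding peval_eq_eval_poly_mapping by (rule eval_id.eval_add)

lemma peval_diff: "peval x (p - q) = peval x p - peval x q"
  unfolding peval_eq_eval_poly_mapping by (rule eval_id.eval_diff)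

lemma peval_sum: "peval x (\<Sum>i\<in>A. f i) = (\<Sum>i\<in>A. peval x (f i))"
  unfolding peval_eq_eval_poly_mapping by (rule eval_id.eval_sum)

lemma peval_mult: "peval x (p * q) = peval x p * peval x q"
  unfolding peval_eq_eval_poly_mapping by (rule eval_id.eval_mult)

interpretation eval_line: coefficient_hom "\<lambda>c :: 'k::field. [:c:]"
  by standard (auto simp: one_pCons)

lemma peval_pconst [simp]: "peval x (pconst c) = c"
  by (simp add: pconst_def peval_def)

lemma peval_pvar [simp]: "peval x (pvar v) = x v"
  by (simp add: pvar_def peval_def)

text \<open>The linear coefficient of \<open>p(x + t d)\<close> as a polynomial in \<open>t\<close>.\<close>

definition dirderiv :: "(sc_var \<Rightarrow> 'k::field) \<Rightarrow> (sc_var \<Rightarrow> 'k) \<Rightarrow> 'k sc_poly \<Rightarrow> 'k" where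
  "dirderiv x d p = coeff (eval_poly_mapping (\<lambda>c. [:c:]) (\<lambda>v. [:x v, d v:]) p) 1"

lemma dirderiv_add: "dirderiv x d (p + q) = dirderiv x d p + dirderiv x d q"
  by (simp add: dirderiv_def eval_line.eval_add)

lemma dirderiv_diff: "dirderiv x d (p - q) = dirderiv x d p - dirderiv x d q"
  by (simp add: dirderiv_def eval_line.eval_diff)

lemma dirderiv_sum: "dirderiv x d (\<Sum>i\<in>A. f i) = (\<Sum>i\<in>A. dirderiv x d (f i))"
  by (simp add: dirderiv_def eval_line.eval_sum coeff_sum)

lemma dirderiv_pconst [simp]: "dirderiv x d (pconst c) = 0"
  by (simp add: dirderiv_def pconst_def eval_line.eval_single)

lemma dirderiv_pvar [simp]: "dirderiv x d (pvar v) = d v"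
  by (simp add: dirderiv_def pvar_def eval_line.eval_single)

lemma coeff_0_eval_line:
  "coeff (eval_poly_mapping (\<lambda>c. [:c:]) (\<lambda>v. [:x v, d v:]) p) 0 = peval x p"
  by (simp add: eval_poly_mapping_def peval_def poly_sum poly_prod flip: poly_0_coeff_0)

text \<open>Leibniz rule: the coefficient of t in a product of two polynomials in t, whose constant
  terms are the values at \<open>x\<close>.\<close>

lemma dirderiv_mult:
  "dirderiv x d (p * q) = peval x p * dirderiv x d q + dirderiv x d p * peval x q"
  unfolding dirderiv_def eval_line.eval_mult by (simp add: coeff_mult coeff_0_eval_line)

section \<open>The polynomial ring in the structure constants\<close>

lemma pconst_mult: "pconst (a * b) = pconst a * pconst b"
  by (simp add: pconst_def mult_single)

lemma sc_ring_pconst [simp]: "pconst c \<in> sc_ring n"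
  by (simp add: sc_ring_def pconst_def)

lemma sc_ring_pvar [simp]: "pvar v \<in> sc_ring n \<longleftrightarrow> v \<in> sc_index n"
  by (simp add: sc_ring_def pvar_def)

lemma sc_ring_zero [simp]: "0 \<in> sc_ring n"
  by (simp add: sc_ring_def)

lemma sc_ring_one [simp]: "1 \<in> sc_ring n"
  by (simp add: sc_ring_def)

lemma sc_ring_add: "p \<in> sc_ring n \<Longrightarrow> q \<in> sc_ring n \<Longrightarrow> p + q \<in> sc_ring n"
  using Poly_Mapping.keys_add[of p q] by (auto simp: sc_ring_def)

lemma sc_ring_mult: "p \<in> sc_ring n \<Longrightarrow> q \<in> sc_ring n \<Longrightarrow> p * q \<in> sc_ring n"
  unfolding sc_ring_def by (auto dest!: subsetD[OF keys_mult] subsetD[OF Poly_Mapping.keys_add])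

lemma sc_ring_diff: "p \<in> sc_ring n \<Longrightarrow> q \<in> sc_ring n \<Longrightarrow> p - q \<in> sc_ring n"
  using sc_ring_add[of p n "pconst (-1) * q"] sc_ring_mult[OF sc_ring_pconst[of "-1"], of q]
  by (simp add: pconst_def single_uminus)

lemma sc_ring_sum: "(\<And>i. i \<in> A \<Longrightarrow> f i \<in> sc_ring n) \<Longrightarrow> (\<Sum>i\<in>A. f i) \<in> sc_ring n"
  by (induction A rule: infinite_finite_induct) (auto intro: sc_ring_add)

text \<open>Constants and variables generate the ring. The proof climbs from powers of one variable
  to monomials and then to sums of monomials.\<close>

lemma sc_ring_induct [consumes 1, case_names pconst pvar add mult]:
  fixes p :: "'k::field sc_poly"
  assumes p: "p \<in> sc_ring n"
    and const: "\<And>c. P (pconst c)"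
    and var: "\<And>v. v \<in> sc_index n \<Longrightarrow> P (pvar v)"
    and add: "\<And>p q. p \<in> sc_ring n \<Longrightarrow> q \<in> sc_ring n \<Longrightarrow> P p \<Longrightarrow> P q \<Longrightarrow> P (p + q)"
    and mult: "\<And>p q. p \<in> sc_ring n \<Longrightarrow> q \<in> sc_ring n \<Longrightarrow> P p \<Longrightarrow> P q \<Longrightarrow> P (p * q)"
  shows "P p"
proof -
  \<comment> \<open>Membership is carried along because \<open>add\<close> and \<open>mult\<close>
    ask for it in both arguments.\<close>
  let ?Q = "\<lambda>p. p \<in> sc_ring n \<and> P p"
  have Q0: "?Q 0" using const[of 0] by (simp add: pconst_def)
  have Q1: "?Q 1" using const[of 1] by (simp add: pconst_def)
  have power: "?Q (Poly_Mapping.single (Poly_Mapping.single v k) 1)" if v: "v \<in> sc_index n" for v k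
  proof (induction k)
    case 0
    then show ?case using Q1 by simp
  next
    case (Suc k)
    have "Poly_Mapping.single (Poly_Mapping.single v (Suc k)) (1 :: 'k) =
        pvar v * Poly_Mapping.single (Poly_Mapping.single v k) 1"
      by (simp add: pvar_def mult_single flip: single_add)
    then show ?case using Suc v by (auto intro!: sc_ring_mult mult var)
  qed
  have monom: "?Q (Poly_Mapping.single (\<Sum>v\<in>A. Poly_Mapping.single v (f v)) 1)"
    if "finite A" "A \<subseteq> sc_index n" for A and f :: "sc_var \<Rightarrow> nat"
    using that
  proof (induction A rule: finite_induct)
    case empty
    then show ?case using Q1 by simp
  next
    case (insert v A)
    have "Poly_Mapping.single (\<Sum>v\<in>insert v A. Poly_Mapping.single v (f v)) (1 :: 'k) =
        Poly_Mapping.single (Poly_Mapping.single v (f v)) 1 *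
        Poly_Mapping.single (\<Sum>v\<in>A. Poly_Mapping.single v (f v)) 1"
      using insert by (simp add: mult_single)
    then show ?case using insert power[of v "f v"] by (auto intro!: sc_ring_mult mult)
  qed
  have "?Q (\<Sum>m\<in>A. Poly_Mapping.single m (Poly_Mapping.lookup p m))"
    if "finite A" "A \<subseteq> Poly_Mapping.keys p" for A
    using that
  proof (induction A rule: finite_induct)
    case empty
    then show ?case using Q0 by simp
  next
    case (insert m A)
    have "Poly_Mapping.keys m \<subseteq> sc_index n"
      using insert.prems p by (auto simp: sc_ring_def)
    then have "?Q (Poly_Mapping.single m 1)"
      using monom[of "Poly_Mapping.keys m" "Poly_Mapping.lookup m"] poly_mapping_sum_single[of m] by simp
    moreover have "Poly_Mapping.single m (Poly_Mapping.lookup p m) =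
        pconst (Poly_Mapping.lookup p m) * Poly_Mapping.single m 1"
      by (simp add: pconst_def mult_single)
    ultimately have "?Q (Poly_Mapping.single m (Poly_Mapping.lookup p m))"
      by (auto intro!: sc_ring_mult mult const)
    then show ?case using insert by (auto intro!: sc_ring_add add)
  qed
  from this[of "Poly_Mapping.keys p"] show ?thesis
    using poly_mapping_sum_single[of p] by simp
qed

section \<open>The associativity ideal and its points\<close>

lemma assoc_poly_in_sc_ring:
  assumes "i < n" "j < n" "k < n" "m < n"
  shows "assoc_poly n i j k m \<in> sc_ring n"
  unfolding assoc_poly_def using assms
  by (intro sc_ring_diff sc_ring_sum sc_ring_mult) (auto simp: sc_index_def)

lemma assoc_poly_in_assoc_ideal:
  assumes "i < n" "j < n" "k < n" "m < n"
  shows "(assoc_poly n i j k m :: 'k::field sc_poly) \<in> assoc_ideal n"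
proof -
  \<comment> \<open>The coefficient family is 1 at one index and 0 elsewhere; nesting the
    conditionals lets the four sums collapse one after another.\<close>
  define g :: "nat \<Rightarrow> nat \<Rightarrow> nat \<Rightarrow> nat \<Rightarrow> 'k sc_poly" where
    "g i' j' k' m' = (if i' = i then if j' = j then if k' = k then if m' = m then 1 else 0 else 0 else 0 else 0)"
    for i' j' k' m'
  have sum_if: "(\<Sum>t<n. if P then f t else 0) = (if P then \<Sum>t<n. f t else 0)"
    for P and f :: "nat \<Rightarrow> 'k sc_poly"
    by simp
  have "(\<Sum>i'<n. \<Sum>j'<n. \<Sum>k'<n. \<Sum>m'<n. g i' j' k' m' * assoc_poly n i' j' k' m') = assoc_poly n i j k m"
    using assms by (simp add: g_def if_distrib[of "\<lambda>g. g * _"] sum_if cong: if_cong)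
  moreover have "\<forall>i<n. \<forall>j<n. \<forall>k<n. \<forall>m<n. g i j k m \<in> sc_ring n" by (simp add: g_def)
  ultimately show ?thesis unfolding assoc_ideal_def by (auto intro!: exI[of _ g])
qed

lemma assoc_ideal_cases:
  assumes "p \<in> assoc_ideal n"
  obtains g where "p = (\<Sum>i<n. \<Sum>j<n. \<Sum>k<n. \<Sum>m<n. g i j k m * assoc_poly n i j k m)"
    and "\<And>i j k m. i < n \<Longrightarrow> j < n \<Longrightarrow> k < n \<Longrightarrow> m < n \<Longrightarrow> g i j k m \<in> sc_ring n"
  using assms unfolding assoc_ideal_def by auto

text \<open>Evaluation respects sums and products, so a point killing the generators kills the whole
  ideal.\<close>

lemma Alg_iff:
  "x \<in> Alg n \<longleftrightarrow> (\<forall>i<n. \<forall>j<n. \<forall>k<n. \<forall>m<n. peval x (assoc_poly n i j k m) = 0)"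
  (is "_ \<longleftrightarrow> ?R")
proof
  assume "x \<in> Alg n"
  then show ?R by (auto simp: Alg_def intro: assoc_poly_in_assoc_ideal)
next
  assume ?R
  then show "x \<in> Alg n"
    by (auto simp: Alg_def peval_sum peval_mult elim!: assoc_ideal_cases)
qed

lemma peval_assoc_poly:
  "peval x (assoc_poly n i j k m) =
    (\<Sum>l<n. x (i, j, l) * x (l, k, m)) - (\<Sum>l<n. x (i, l, m) * x (j, k, l))"
  by (simp add: assoc_poly_def peval_diff peval_sum peval_mult)

text \<open>The linearised associativity equation, in the form that is later matched with the
  cocycle identity.\<close>

lemma dirderiv_assoc_poly:
  "dirderiv x d (assoc_poly n i j k m) =
    (\<Sum>l<n. x (i, j, l) * d (l, k, m) + d (i, j, l) * x (l, k, m)) -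
    (\<Sum>l<n. x (i, l, m) * d (j, k, l) + d (i, l, m) * x (j, k, l))"
  by (simp add: assoc_poly_def dirderiv_diff dirderiv_sum dirderiv_mult)

section \<open>Tangent vectors as point derivations\<close>

lemma point_ideal_mem: "p \<in> point_ideal n x \<longleftrightarrow> p \<in> sc_ring n \<and> peval x p = 0"
  by (simp add: point_ideal_def)

text \<open>
  A tangent vector \<open>\<phi>\<close> extends to the point derivation \<open>p \<mapsto> \<phi> (p - p(x))\<close> of the polynomial ring.
\<close>

lemma tangent_space_eq_dirderiv:
  assumes \<phi>: "\<phi> \<in> tangent_space n x" and p: "p \<in> sc_ring n"
  shows "\<phi> (p - pconst (peval x p)) = dirderiv x (\<lambda>v. \<phi> (pvar v - pconst (x v))) p"
proof -
  have \<phi>_add: "\<phi> (p + q) = \<phi> p + \<phi> q" if "p \<in> point_ideal n x" "q \<in> point_ideal n x" for p q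
    using \<phi> that by (simp add: tangent_space_def)
  have \<phi>_scale: "\<phi> (pconst c * p) = c * \<phi> p" if "p \<in> point_ideal n x" for c p
    using \<phi> that by (simp add: tangent_space_def)
  show ?thesis using p
  proof (induction p rule: sc_ring_induct)
    case (pconst c)
    \<comment> \<open>A constant minus its value is 0, and homogeneity with scalar 0 gives
      \<open>\<phi> 0 = 0\<close>.\<close>
    have "\<phi> (pconst 0 * 0) = 0 * \<phi> 0"
      by (rule \<phi>_scale) (simp add: point_ideal_mem)
    then show ?case by simp
  next
    case (pvar v)
    then show ?case by simp
  next
    case (add p q)
    have "p + q - pconst (peval x (p + q)) = (p - pconst (peval x p)) + (q - pconst (peval x q))"
      by (simp add: pconst_def single_add peval_add)
    also have "\<phi> \<dots> = \<phi> (p - pconst (peval x p)) + \<phi> (q - pconst (peval x q))"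
      using add by (intro \<phi>_add) (simp_all add: point_ideal_mem sc_ring_diff peval_diff)
    finally show ?case
      using add by (simp add: dirderiv_add)
  next
    case (mult p q)
    define p' where "p' = p - pconst (peval x p)"
    define q' where "q' = q - pconst (peval x q)"
    have I: "p' \<in> point_ideal n x" "q' \<in> point_ideal n x"
      using mult by (auto simp: p'_def q'_def point_ideal_mem sc_ring_diff peval_diff)
    have scaled: "pconst c * r \<in> point_ideal n x" if "r \<in> point_ideal n x" for c r
      using that by (auto simp: point_ideal_mem peval_mult intro!: sc_ring_mult)
    have add_I: "r + s \<in> point_ideal n x" if "r \<in> point_ideal n x" "s \<in> point_ideal n x" for r s
      using that by (auto simp: point_ideal_mem peval_add intro!: sc_ring_add)
    have sq: "p' * q' \<in> ideal_square (point_ideal n x)"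
      unfolding ideal_square_def using I
      by (intro CollectI exI[of _ "1 :: nat"] exI[of _ "\<lambda>_. p'"] exI[of _ "\<lambda>_. q'"]) simp
    have pq: "p' * q' \<in> point_ideal n x"
      using I by (auto simp: point_ideal_mem peval_mult intro!: sc_ring_mult)
    \<comment> \<open>Expanding around the values at \<open>x\<close> leaves \<open>p' * q'\<close>,
      which lies in the square of the ideal and is killed by \<open>\<phi>\<close>; the two other
      terms form the Leibniz rule.\<close>
    have "p * q - pconst (peval x (p * q)) =
        p' * q' + (pconst (peval x p) * q' + pconst (peval x q) * p')"
      by (simp add: p'_def q'_def peval_mult pconst_mult) (simp add: algebra_simps)
    also have "\<phi> \<dots> = \<phi> (p' * q') + (peval x p * \<phi> q' + peval x q * \<phi> p')"
      using I scaled add_I pq by (simp only: \<phi>_add \<phi>_scale)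
    also have "\<phi> (p' * q') = 0" using \<phi> sq by (simp add: tangent_space_def)
    finally show ?case
      using mult.IH by (simp add: p'_def q'_def dirderiv_mult)
  qed
qed

text \<open>By the Leibniz rule the derivative at \<open>x\<close> kills products of two polynomials
  vanishing at \<open>x\<close>. It also kills multiples of a polynomial whose value and derivative
  both vanish there, so the condition on the generators reaches the whole ideal.\<close>

lemma dirderiv_in_tangent_space:
  assumes x: "x \<in> Alg n"
    and d: "\<And>i j k m. i < n \<Longrightarrow> j < n \<Longrightarrow> k < n \<Longrightarrow> m < n \<Longrightarrow> dirderiv x d (assoc_poly n i j k m) = 0"
  shows "(\<lambda>p. if p \<in> point_ideal n x then dirderiv x d p else 0) \<in> tangent_space n x"
    (is "?\<phi> \<in> _")
proof -
  have "dirderiv x d p = 0" if p: "p \<in> ideal_square (point_ideal n x)" for p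
    using p by (auto simp: ideal_square_def dirderiv_sum dirderiv_mult point_ideal_mem)
  moreover have "dirderiv x d p = 0" if "p \<in> assoc_ideal n" for p
    using that x d
    by (auto simp: dirderiv_sum dirderiv_mult Alg_iff elim!: assoc_ideal_cases)
  ultimately show ?thesis
    by (auto simp: tangent_space_def dirderiv_add dirderiv_mult point_ideal_mem peval_add
        peval_mult sc_ring_add sc_ring_mult)
qed

text \<open>A direction is a function on all triples, but the ring sees only the variables in
  \<open>sc_index n\<close>.\<close>

lemma dirderiv_cong:
  assumes "p \<in> sc_ring n" and "\<And>v. v \<in> sc_index n \<Longrightarrow> d v = d' v"
  shows "dirderiv x d p = dirderiv x d' p"
  using assms(1)
  by (induction p rule: sc_ring_induct) (simp_all add: assms(2) dirderiv_add dirderiv_mult)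

lemma subspace_tangent_space:
  "module.subspace (scale1 (*)) (tangent_space n (x :: sc_var \<Rightarrow> 'k::field))"
proof -
  interpret vector_space "scale1 (*) :: 'k \<Rightarrow> ('k sc_poly \<Rightarrow> 'k) \<Rightarrow> _"
    by (intro vector_space_scale1 vector_space_times)
  show ?thesis
    by (auto simp: subspace_def tangent_space_def scale1_def distrib_left)
qed

subsection \<open>Trace forms and the Casimir element\<close>

locale based_space = vector_space scale
  for scale :: "'k::field \<Rightarrow> 'v::ab_group_add \<Rightarrow> 'v" +
  fixes e :: "nat \<Rightarrow> 'v" and n :: nat
  assumes basis: "indexed_basis scale e n"
begin

sublocale endo: vector_space_pair scale scale ..

abbreviation lin :: "('v \<Rightarrow> 'v) \<Rightarrow> bool" where
  "lin \<equiv> Vector_Spaces.linear scale scale"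

abbreviation cf :: "'v \<Rightarrow> nat \<Rightarrow> 'k" where
  "cf \<equiv> coord scale e n"

abbreviation tr :: "('v \<Rightarrow> 'v) \<Rightarrow> 'k" where
  "tr \<equiv> endo_trace scale e n"

section \<open>Coordinates and traces in the fixed basis\<close>

lemma inj_basis: "inj_on e {..<n}"
  and independent_basis: "independent (e ` {..<n})"
  and span_basis: "span (e ` {..<n}) = UNIV"
  using basis by (auto simp: indexed_basis_def)

lemma lin_iff: "lin f \<longleftrightarrow> (\<forall>a b. f (a + b) = f a + f b) \<and> (\<forall>c a. f (scale c a) = scale c (f a))"
  by (simp add: Vector_Spaces.linear_iff vector_space_axioms)

lemma coord_add: "cf (a + b) i = cf a i + cf b i"
  by (simp add: coord_def representation_add independent_basis span_basis)

lemma coord_scale: "cf (scale c a) i = c * cf a i"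
  by (simp add: coord_def representation_scale independent_basis span_basis)

lemma coord_zero [simp]: "cf 0 i = 0"
  by (simp add: coord_def representation_zero)

lemma coord_diff: "cf (a - b) i = cf a i - cf b i"
  by (simp add: coord_def representation_diff independent_basis span_basis)

lemma coord_sum: "cf (\<Sum>j\<in>A. f j) i = (\<Sum>j\<in>A. cf (f j) i)"
  by (induction A rule: infinite_finite_induct) (auto simp: coord_add)

lemma coord_basis: "i < n \<Longrightarrow> j < n \<Longrightarrow> cf (e i) j = (if j = i then 1 else 0)"
  using inj_basis by (auto simp: coord_def representation_basis independent_basis inj_on_def)

lemma sum_coord_basis: "(\<Sum>i<n. scale (cf v i) (e i)) = v"
proof -
  have "(\<Sum>i<n. scale (cf v i) (e i)) = (\<Sum>b\<in>e ` {..<n}. scale (representation (e ` {..<n}) v b) b)"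
    by (simp add: sum.reindex[OF inj_basis] coord_def)
  also have "\<dots> = v"
    by (rule sum_representation_eq) (auto simp: independent_basis span_basis)
  finally show ?thesis .
qed

lemma coord_combination: "j < n \<Longrightarrow> cf (\<Sum>i<n. scale (c i) (e i)) j = c j"
  by (simp add: coord_sum coord_scale coord_basis if_distrib[of "(*) _"] cong: if_cong)

lemma coord_eqI: "(\<And>i. i < n \<Longrightarrow> cf a i = cf b i) \<Longrightarrow> a = b"
  by (subst sum_coord_basis[of a, symmetric], subst sum_coord_basis[of b, symmetric]) simp

lemma lin_expand:
  assumes "lin f"
  shows "f v = (\<Sum>i<n. scale (cf v i) (f (e i)))"
proof -
  have "f v = f (\<Sum>i<n. scale (cf v i) (e i))" by (simp add: sum_coord_basis)
  also have "\<dots> = (\<Sum>i<n. scale (cf v i) (f (e i)))"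
    using assms by (simp add: endo.linear_sum endo.linear_scale)
  finally show ?thesis .
qed

lemma lin_eqI: "lin f \<Longrightarrow> lin g \<Longrightarrow> (\<And>i. i < n \<Longrightarrow> f (e i) = g (e i)) \<Longrightarrow> f = g"
  by (rule ext, subst lin_expand[of f], assumption, subst lin_expand[of g], assumption) simp

text \<open>Both traces are the same double sum of products of matrix entries, with the order of
  summation exchanged.\<close>

lemma trace_commute:
  assumes "lin f" "lin g"
  shows "tr (\<lambda>v. f (g v)) = tr (\<lambda>v. g (f v))"
proof -
  have *: "cf (f (g (e i))) i = (\<Sum>j<n. cf (g (e i)) j * cf (f (e j)) i)" if "lin f" for f g and i
    by (subst lin_expand[OF that]) (simp add: coord_sum coord_scale)
  have "tr (\<lambda>v. f (g v)) = (\<Sum>i<n. \<Sum>j<n. cf (g (e i)) j * cf (f (e j)) i)"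
    by (simp add: endo_trace_def *[OF assms(1)])
  also have "\<dots> = (\<Sum>i<n. \<Sum>j<n. cf (f (e i)) j * cf (g (e j)) i)"
    by (subst sum.swap) (simp add: mult.commute)
  also have "\<dots> = tr (\<lambda>v. g (f v))"
    by (simp add: endo_trace_def *[OF assms(2)])
  finally show ?thesis .
qed

lemma trace_add: "tr (\<lambda>v. f v + g v) = tr f + tr g"
  by (simp add: endo_trace_def coord_add sum.distrib)

lemma trace_scale: "tr (\<lambda>v. scale c (f v)) = c * tr f"
  by (simp add: endo_trace_def coord_scale sum_distrib_left)

end

text \<open>The algebra at a point of the separable locus; the determinant is the one in
  \<open>discr\<close>. Its unit is constructed below from the trace form.\<close>

locale based_algebra = based_space scale e n
  for scale :: "'k::field \<Rightarrow> 'v::ab_group_add \<Rightarrow> 'v" and e n +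
  fixes mult :: "'v \<Rightarrow> 'v \<Rightarrow> 'v" (infixl \<open>**\<close> 70)
  assumes lin_mult_right: "lin (\<lambda>b. a ** b)"
    and lin_mult_left: "lin (\<lambda>a. a ** b)"
    and mult_assoc: "(a ** b) ** c = a ** (b ** c)"
    and trace_form_nondegenerate: "det (mat n n (\<lambda>(i, j). tr (\<lambda>c. (e i ** e j) ** c))) \<noteq> 0"
begin

definition T :: "'v \<Rightarrow> 'v \<Rightarrow> 'k" where
  "T a b = tr (\<lambda>c. (a ** b) ** c)"

lemmas mult_add_right = endo.linear_add[OF lin_mult_right]
  and mult_add_left = endo.linear_add[OF lin_mult_left]
  and mult_diff_right = endo.linear_diff[OF lin_mult_right]
  and mult_diff_left = endo.linear_diff[OF lin_mult_left]
  and mult_scale_right = endo.linear_scale[OF lin_mult_right]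
  and mult_scale_left = endo.linear_scale[OF lin_mult_left]
  and mult_sum_right = endo.linear_sum[OF lin_mult_right]
  and mult_sum_left = endo.linear_sum[OF lin_mult_left]

lemma T_add_left: "T (a + a') b = T a b + T a' b"
  and T_add_right: "T a (b + b') = T a b + T a b'"
  and T_scale_left: "T (scale c a) b = c * T a b"
  and T_scale_right: "T a (scale c b) = c * T a b"
  by (simp_all add: T_def mult_add_left mult_add_right mult_scale_left mult_scale_right
      trace_add trace_scale)

lemma T_zero_left [simp]: "T 0 b = 0"
  using T_scale_left[of 0 0 b] by simp

lemma T_zero_right [simp]: "T a 0 = 0"
  using T_scale_right[of a 0 0] by simp

lemma T_sum_left: "T (\<Sum>i\<in>A. f i) b = (\<Sum>i\<in>A. T (f i) b)"
  by (induction A rule: infinite_finite_induct) (auto simp: T_add_left)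

lemma T_sum_right: "T a (\<Sum>i\<in>A. f i) = (\<Sum>i\<in>A. T a (f i))"
  by (induction A rule: infinite_finite_induct) (auto simp: T_add_right)

text \<open>By associativity, left multiplication by a product is a composite of left
  multiplications, and the trace is symmetric on composites.\<close>

lemma T_commute: "T a b = T b a"
  unfolding T_def mult_assoc by (rule trace_commute[OF lin_mult_right lin_mult_right])

lemma T_assoc: "T (a ** b) c = T a (b ** c)"
  by (simp add: T_def mult_assoc)

text \<open>The columns of the inverse of the Gram matrix hold the coordinates of the dual
  basis.\<close>

lemma dual_basis_exists:
  "\<exists>d. \<forall>i<n. \<forall>j<n. T (e i) (d j) = (if i = j then 1 else 0)"
proof -
  let ?G = "mat n n (\<lambda>(i, j). T (e i) (e j))"
  have "?G \<in> Units (ring_mat TYPE('k) n ())"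
    by (rule det_non_zero_imp_unit) (use trace_form_nondegenerate in \<open>simp_all add: T_def\<close>)
  then obtain H where H: "H \<in> carrier_mat n n" "?G * H = 1\<^sub>m n"
    by (auto simp: Units_def ring_mat_def)
  have "T (e i) (\<Sum>k<n. scale (H $$ (k, j)) (e k)) = (if i = j then 1 else 0)" if "i < n" "j < n" for i j
  proof -
    have "T (e i) (\<Sum>k<n. scale (H $$ (k, j)) (e k)) = (?G * H) $$ (i, j)"
      using that H(1)
      by (simp add: T_sum_right T_scale_right scalar_prod_def mult.commute lessThan_atLeast0)
    also have "\<dots> = (if i = j then 1 else 0)" using that by (simp add: H(2))
    finally show ?thesis .
  qed
  then show ?thesis
    by (intro exI[of _ "\<lambda>j. \<Sum>k<n. scale (H $$ (k, j)) (e k)"]) simp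
qed

definition dual :: "nat \<Rightarrow> 'v" where
  "dual = (SOME d. \<forall>i<n. \<forall>j<n. T (e i) (d j) = (if i = j then 1 else 0))"

lemma T_basis_dual: "i < n \<Longrightarrow> j < n \<Longrightarrow> T (e i) (dual j) = (if i = j then 1 else 0)"
  using someI_ex[OF dual_basis_exists] unfolding dual_def by blast

lemma T_dual:
  assumes "j < n"
  shows "T a (dual j) = cf a j"
proof -
  have "T a (dual j) = T (\<Sum>i<n. scale (cf a i) (e i)) (dual j)" by (simp add: sum_coord_basis)
  also have "\<dots> = cf a j"
    using assms by (simp add: T_sum_left T_scale_left T_basis_dual if_distrib[of "(*) _"] cong: if_cong)
  finally show ?thesis .
qed

lemma T_eqI: "(\<And>b. T a b = T a' b) \<Longrightarrow> a = a'"
  by (rule coord_eqI) (simp flip: T_dual)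

text \<open>Both sides pair equally with every \<open>e i\<close>, and the form is symmetric and
  nondegenerate.\<close>

lemma sum_T_dual: "(\<Sum>j<n. scale (T (e j) b) (dual j)) = b" (is "?s = b")
proof (rule T_eqI)
  fix c
  have "T (e i) ?s = T (e i) b" if "i < n" for i
    using that by (simp add: T_sum_right T_scale_right T_basis_dual if_distrib[of "(*) _"] cong: if_cong)
  then have "T (\<Sum>i<n. scale (cf c i) (e i)) ?s = T (\<Sum>i<n. scale (cf c i) (e i)) b"
    unfolding T_sum_left[of _ _ ?s] T_sum_left[of _ _ b] T_scale_left by (intro sum.cong) auto
  then show "T ?s c = T b c" by (simp add: sum_coord_basis T_commute)
qed

text \<open>
  The Casimir element \<open>\<Sum>i. e i \<otimes> dual i\<close> commutes with every algebra element; it is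
  a separability idempotent because its product \<open>\<Sum>i. e i ** dual i\<close> is the unit.
\<close>

lemma casimir_commutes:
  assumes B1: "\<And>b. lin (\<lambda>a. B a b)" and B2: "\<And>a. lin (B a)"
  shows "(\<Sum>i<n. B (a ** e i) (dual i)) = (\<Sum>i<n. B (e i) (dual i ** a))"
proof -
  \<comment> \<open>The bilinear \<open>B\<close> stands for a linear map out of the tensor square.
    First \<open>a ** e i\<close> is expanded in the basis, its coordinates being pairings with the
    dual basis.\<close>
  have "(\<Sum>i<n. B (a ** e i) (dual i)) =
      (\<Sum>i<n. \<Sum>j<n. scale (T (a ** e i) (dual j)) (B (e j) (dual i)))"
    by (subst lin_expand[OF B1]) (simp add: T_dual)
  also have "\<dots> = (\<Sum>j<n. \<Sum>i<n. scale (T (e i) (dual j ** a)) (B (e j) (dual i)))"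
  proof (subst sum.swap, intro sum.cong refl)
    fix i j
    \<comment> \<open>Symmetry and invariance of the form move \<open>a\<close> from the basis
      vector to the dual vector.\<close>
    have "T (a ** e i) (dual j) = T (e i) (dual j ** a)"
      by (metis T_assoc T_commute)
    then show "scale (T (a ** e i) (dual j)) (B (e j) (dual i)) =
        scale (T (e i) (dual j ** a)) (B (e j) (dual i))" by simp
  qed
  also have "\<dots> = (\<Sum>j<n. B (e j) (\<Sum>i<n. scale (T (e i) (dual j ** a)) (dual i)))"
    by (simp add: endo.linear_sum[OF B2] endo.linear_scale[OF B2])
  finally show ?thesis by (simp add: sum_T_dual)
qed

definition unit :: 'v where
  "unit = (\<Sum>i<n. e i ** dual i)"

text \<open>Cyclic invariance turns each summand into the pairing of \<open>a ** e i\<close> with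
  \<open>dual i\<close>, which is the i-th diagonal entry of left multiplication by
  \<open>a\<close>.\<close>

lemma T_unit: "T unit a = tr (\<lambda>c. a ** c)"
proof -
  have "T (e i ** dual i) a = T (a ** e i) (dual i)" for i
    by (metis T_assoc T_commute)
  then show ?thesis
    by (simp add: unit_def T_sum_left T_dual endo_trace_def)
qed

text \<open>Pairing \<open>unit ** a\<close> with b gives the trace of left multiplication by
  \<open>a ** b\<close>, which is \<open>T a b\<close>; nondegeneracy does the rest.\<close>

lemma unit_left [simp]: "unit ** a = a"
  by (rule T_eqI) (simp add: T_assoc T_unit, simp add: T_def)

subsection \<open>Vanishing of Hochschild cohomology in degrees 1 and 2\<close>

abbreviation Z2 :: "('v \<Rightarrow> 'v \<Rightarrow> 'v) set" where
  "Z2 \<equiv> hochschild_Z2 scale mult"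

definition coboundary :: "('v \<Rightarrow> 'v) \<Rightarrow> 'v \<Rightarrow> 'v \<Rightarrow> 'v" where
  "coboundary g = (\<lambda>a b. a ** g b - g (a ** b) + g a ** b)"

lemma coboundary_in_Z2:
  assumes g: "lin g"
  shows "coboundary g \<in> Z2"
  unfolding hochschild_Z2_def
proof (intro CollectI conjI allI)
  fix a b c
  note simps = mult_add_right mult_add_left mult_diff_right mult_diff_left mult_scale_right
    mult_scale_left endo.linear_add[OF g] endo.linear_scale[OF g]
    scale_right_distrib scale_right_diff_distrib mult_assoc
  show "lin (coboundary g a)"
    unfolding lin_iff coboundary_def by (simp add: simps)
  show "lin (\<lambda>a. coboundary g a b)"
    unfolding lin_iff coboundary_def by (simp add: simps)
  show "a ** coboundary g b c - coboundary g (a ** b) c + coboundary g a (b ** c) -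
      coboundary g a b ** c = 0"
    unfolding coboundary_def by (simp add: simps)
qed

text \<open>Vanishing of the second Hochschild cohomology of the algebra with coefficients in
  itself; contraction with the Casimir element is the homotopy.\<close>

lemma Z2_eq_coboundaries: "Z2 = coboundary ` {g. lin g}"
proof
  show "coboundary ` {g. lin g} \<subseteq> Z2" using coboundary_in_Z2 by blast
  show "Z2 \<subseteq> coboundary ` {g. lin g}"
  proof
    fix f assume "f \<in> Z2"
    then have f1: "lin (f a)" and f2: "lin (\<lambda>a. f a b)"
      and cocycle: "a ** f b c - f (a ** b) c + f a (b ** c) - f a b ** c = 0" for a b c
      by (simp_all add: hochschild_Z2_def)
    define g where "g a = (\<Sum>i<n. e i ** f (dual i) a)" for a
    have "lin g"
      unfolding lin_iff g_def
      by (simp add: endo.linear_add[OF f1] endo.linear_scale[OF f1] mult_add_right mult_scale_right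
          sum.distrib scale_sum_right)
    moreover have "coboundary g a b = f a b" for a b
    proof -
      have "a ** g b = (\<Sum>i<n. (a ** e i) ** f (dual i) b)"
        by (simp add: g_def mult_sum_right mult_assoc)
      also have "\<dots> = (\<Sum>i<n. e i ** f (dual i ** a) b)"
        by (rule casimir_commutes[of "\<lambda>u v. u ** f v b"])
          (simp_all add: lin_mult_left lin_iff endo.linear_add[OF f2] endo.linear_scale[OF f2]
            mult_add_right mult_scale_right)
      finally have 1: "a ** g b = (\<Sum>i<n. e i ** f (dual i ** a) b)" .
      \<comment> \<open>The cocycle identity at \<open>dual i\<close>, \<open>a\<close>,
        \<open>b\<close>. Multiplied on the left by \<open>e i\<close> and summed, its right side
        becomes \<open>unit ** f a b\<close> and its left side becomes the coboundary of
        \<open>g\<close>.\<close>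
      have "f (dual i ** a) b - f (dual i) (a ** b) + f (dual i) a ** b = dual i ** f a b" for i
        using cocycle[of "dual i" a b] by (simp add: algebra_simps)
      then have "(\<Sum>i<n. e i ** (f (dual i ** a) b - f (dual i) (a ** b) + f (dual i) a ** b)) =
          unit ** f a b"
        by (simp add: unit_def mult_sum_left mult_assoc)
      then show ?thesis
        unfolding coboundary_def 1
        by (simp add: g_def mult_sum_left mult_assoc mult_add_right mult_diff_right sum.distrib sum_subtractf)
    qed
    ultimately show "f \<in> coboundary ` {g. lin g}"
      by (intro image_eqI[of _ _ g]) (auto simp: fun_eq_iff)
  qed
qed

abbreviation Der :: "('v \<Rightarrow> 'v) set" where
  "Der \<equiv> derivations scale mult"

lemma coboundary_kernel: "{g. lin g \<and> coboundary g = 0} = Der"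
  by (auto simp: derivations_def coboundary_def fun_eq_iff algebra_simps)

text \<open>The Hochschild differential in degree 0, so its kernel is the centre.\<close>

definition inner :: "'v \<Rightarrow> 'v \<Rightarrow> 'v" where
  "inner d = (\<lambda>a. a ** d - d ** a)"

lemma inner_in_Der: "inner d \<in> Der"
  by (simp add: derivations_def inner_def lin_iff mult_add_right mult_add_left mult_diff_right
      mult_diff_left mult_scale_right mult_scale_left scale_right_diff_distrib mult_assoc)

lemma Der_eq_inner: "Der = range inner"
proof
  show "range inner \<subseteq> Der" using inner_in_Der by blast
  show "Der \<subseteq> range inner"
  proof
    fix D assume "D \<in> Der"
    then have D: "lin D" and leibniz: "D (a ** b) = D a ** b + a ** D b" for a b
      by (simp_all add: derivations_def)
    \<comment> \<open>Contraction of \<open>D\<close> with the Casimir element. After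
      \<open>a\<close> has been moved to the dual vectors, the Leibniz rule splits
      \<open>a ** d\<close> into \<open>d ** a\<close> and \<open>unit ** D a\<close>.\<close>
    define d where "d = (\<Sum>i<n. e i ** D (dual i))"
    have "inner d a = D a" for a
    proof -
      have "a ** d = (\<Sum>i<n. (a ** e i) ** D (dual i))"
        by (simp add: d_def mult_sum_right mult_assoc)
      also have "\<dots> = (\<Sum>i<n. e i ** D (dual i ** a))"
        by (rule casimir_commutes[of "\<lambda>u v. u ** D v"])
          (simp_all add: lin_mult_left lin_iff endo.linear_add[OF D] endo.linear_scale[OF D]
            mult_add_right mult_scale_right)
      also have "\<dots> = d ** a + unit ** D a"
        by (simp add: leibniz mult_add_right sum.distrib d_def unit_def mult_sum_left mult_assoc)
      finally show ?thesis by (simp add: inner_def)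
    qed
    then have "D = inner d" by (simp add: fun_eq_iff)
    then show "D \<in> range inner" by blast
  qed
qed

lemma inner_kernel: "{d. inner d = 0} = centre mult"
  by (auto simp: centre_def inner_def fun_eq_iff)

end

subsection \<open>Tangent vectors as cocycles\<close>

context based_space
begin

section \<open>Dimensions of V and of its endomorphism space\<close>

lemma dim_UNIV: "dim UNIV = n"
  by (rule dim_unique[of "e ` {..<n}"])
    (auto simp: independent_basis span_basis card_image[OF inj_basis])

lemma vector_space_maps: "vector_space (scale1 scale)"
  by (rule vector_space_scale1) (rule vector_space_axioms)

lemma vector_space_bimaps: "vector_space (scale2 scale)"
  by (rule vector_space_scale2) (rule vector_space_axioms)

lemma subspace_lin: "module.subspace (scale1 scale) {g. lin g}"
proof -
  interpret maps: vector_space "scale1 scale" by (rule vector_space_maps)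
  show ?thesis
    by (auto simp: maps.subspace_def lin_iff scale1_def scale_right_distrib mult.commute)
qed

text \<open>The matrix units span the endomorphisms; this is the finite spanning set required for
  rank-nullity.\<close>

lemma lin_in_span:
  assumes "lin g"
  shows "g \<in> module.span (scale1 scale) ((\<lambda>(i, j) v. scale (cf v j) (e i)) ` ({..<n} \<times> {..<n}))"
proof -
  interpret maps: vector_space "scale1 scale" by (rule vector_space_maps)
  let ?E = "\<lambda>(i, j) v. scale (cf v j) (e i)"
  have expand: "g v = (\<Sum>j<n. \<Sum>i<n. scale (cf (g (e j)) i) (scale (cf v j) (e i)))" for v
  proof -
    have "g v = (\<Sum>j<n. scale (cf v j) (\<Sum>i<n. scale (cf (g (e j)) i) (e i)))"
      unfolding sum_coord_basis by (rule lin_expand[OF assms])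
    then show ?thesis by (simp add: scale_sum_right mult.commute)
  qed
  have "g = (\<Sum>j<n. \<Sum>i<n. scale1 scale (cf (g (e j)) i) (?E (i, j)))"
    by (rule ext, subst expand) (simp add: sum_apply scale1_def)
  also have "\<dots> \<in> maps.span (?E ` ({..<n} \<times> {..<n}))"
    by (intro maps.span_sum maps.span_scale maps.span_base imageI) auto
  finally show ?thesis .
qed

text \<open>Passing to the matrix, extended by 0 outside the index square, identifies endomorphisms
  with functions supported on that square.\<close>

lemma dim_lin: "vector_space.dim (scale1 scale) {g. lin g} = n * n"
proof -
  define M where "M g = (\<lambda>(i, j). if i < n \<and> j < n then cf (g (e j)) i else 0)" for g :: "'v \<Rightarrow> 'v"
  have "Vector_Spaces.linear (scale1 scale) (scale1 (*)) M"
    unfolding Vector_Spaces.linear_iff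
    by (auto simp: M_def vector_space_maps vector_space_scale1 vector_space_times scale1_def
        fun_eq_iff coord_add coord_scale)
  moreover have "inj_on M {g. lin g}"
  proof (rule inj_onI)
    fix g h assume "g \<in> {g. lin g}" "h \<in> {g. lin g}" and eq: "M g = M h"
    moreover have "g (e j) = h (e j)" if "j < n" for j
    proof (rule coord_eqI)
      fix i assume "i < n"
      then show "cf (g (e j)) i = cf (h (e j)) i"
        using fun_cong[OF eq, of "(i, j)"] that by (simp add: M_def)
    qed
    ultimately show "g = h" by (intro lin_eqI) auto
  qed
  ultimately have "vector_space.dim (scale1 scale) {g. lin g} =
      vector_space.dim (scale1 (*)) (M ` {g. lin g})"
    using dim_image_inj_on subspace_lin by metis
  also have "M ` {g. lin g} = {c. \<forall>p. p \<notin> {..<n} \<times> {..<n} \<longrightarrow> c p = 0}"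
  proof (intro equalityI subsetI)
    fix c :: "nat \<times> nat \<Rightarrow> 'k" assume c: "c \<in> {c. \<forall>p. p \<notin> {..<n} \<times> {..<n} \<longrightarrow> c p = 0}"
    define g where "g v = (\<Sum>j<n. scale (cf v j) (\<Sum>i<n. scale (c (i, j)) (e i)))" for v
    have "lin g"
      by (simp add: lin_iff g_def coord_add coord_scale algebra_simps sum.distrib
          scale_sum_right)
    moreover have "g (e j) = (\<Sum>i<n. scale (c (i, j)) (e i))" if "j < n" for j
      using that
      by (simp add: g_def coord_basis if_distrib[of "\<lambda>a. scale a _"] cong: if_cong)
    then have "M g = c"
      using c by (auto simp: M_def fun_eq_iff coord_combination)
    ultimately show "c \<in> M ` {g. lin g}" by blast
  qed (auto simp: M_def)
  also have "vector_space.dim (scale1 (*)) \<dots> = n * n"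
    by (subst dim_functions_supported_on) auto
  finally show ?thesis .
qed

section \<open>Bilinear products and their structure constants\<close>

lemma coord_product_of:
  "m < n \<Longrightarrow> cf (product_of scale e n x a b) m = (\<Sum>i<n. \<Sum>j<n. cf a i * cf b j * x (i, j, m))"
  by (simp add: product_of_def coord_sum coord_scale coord_basis if_distrib[of "(*) _"] cong: if_cong)

lemma lin_product_of_right: "lin (\<lambda>b. product_of scale e n x a b)"
  by (simp add: lin_iff product_of_def coord_add coord_scale algebra_simps sum.distrib scale_sum_right)

lemma lin_product_of_left: "lin (\<lambda>a. product_of scale e n x a b)"
  by (simp add: lin_iff product_of_def coord_add coord_scale algebra_simps sum.distrib scale_sum_right)

lemmas product_of_add = endo.linear_add[OF lin_product_of_left] endo.linear_add[OF lin_product_of_right]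
  and product_of_scale = endo.linear_scale[OF lin_product_of_left] endo.linear_scale[OF lin_product_of_right]

lemma coord_product_of_basis_left:
  "i < n \<Longrightarrow> m < n \<Longrightarrow> cf (product_of scale e n x (e i) b) m = (\<Sum>l<n. cf b l * x (i, l, m))"
  unfolding coord_product_of
  by (subst sum.swap) (simp add: coord_basis if_distrib[of "\<lambda>a. a * _"] cong: if_cong)

lemma coord_product_of_basis_right:
  "k < n \<Longrightarrow> m < n \<Longrightarrow> cf (product_of scale e n x a (e k)) m = (\<Sum>l<n. cf a l * x (l, k, m))"
  by (simp add: coord_product_of coord_basis if_distrib[of "(*) _"] if_distrib[of "\<lambda>a. a * _"]
      cong: if_cong)

lemma coord_product_of_basis:
  "i < n \<Longrightarrow> j < n \<Longrightarrow> l < n \<Longrightarrow> cf (product_of scale e n x (e i) (e j)) l = x (i, j, l)"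
  by (simp add: coord_product_of_basis_right coord_basis if_distrib[of "\<lambda>a. a * _"] cong: if_cong)

lemma product_of_cong:
  "(\<And>v. v \<in> sc_index n \<Longrightarrow> x v = y v) \<Longrightarrow> product_of scale e n x = product_of scale e n y"
  by (simp add: product_of_def sc_index_def fun_eq_iff)

lemma bilinear_eqI:
  assumes "\<And>a. lin (f a)" "\<And>b. lin (\<lambda>a. f a b)" "\<And>a. lin (g a)" "\<And>b. lin (\<lambda>a. g a b)"
    and "\<And>i j. i < n \<Longrightarrow> j < n \<Longrightarrow> f (e i) (e j) = g (e i) (e j)"
  shows "f a b = g a b"
proof -
  have "f (e i) = g (e i)" if "i < n" for i
    using that assms by (intro lin_eqI) auto
  then have "(\<lambda>a. f a b) = (\<lambda>a. g a b)"
    using assms by (intro lin_eqI) auto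
  then show ?thesis by (rule fun_cong)
qed

lemma trilinear_eqI:
  assumes "\<And>a b. lin (f a b)" "\<And>a c. lin (\<lambda>b. f a b c)" "\<And>b c. lin (\<lambda>a. f a b c)"
    and "\<And>a b. lin (g a b)" "\<And>a c. lin (\<lambda>b. g a b c)" "\<And>b c. lin (\<lambda>a. g a b c)"
    and "\<And>i j k. i < n \<Longrightarrow> j < n \<Longrightarrow> k < n \<Longrightarrow> f (e i) (e j) (e k) = g (e i) (e j) (e k)"
  shows "f a b c = g a b c"
proof -
  have "f (e i) b c = g (e i) b c" if "i < n" for i
    by (rule bilinear_eqI[of "f (e i)" "g (e i)", OF assms(1,2,4,5)]) (rule assms(7)[OF that])
  then have "(\<lambda>a. f a b c) = (\<lambda>a. g a b c)"
    by (rule lin_eqI[of "\<lambda>a. f a b c" "\<lambda>a. g a b c", OF assms(3,6)])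
  then show ?thesis by (rule fun_cong)
qed

lemma product_of_surj:
  assumes "\<And>a. lin (f a)" "\<And>b. lin (\<lambda>a. f a b)"
  shows "f = product_of scale e n (\<lambda>(i, j, l). cf (f (e i) (e j)) l)"
    (is "f = ?p")
proof (intro ext)
  fix a b
  show "f a b = ?p a b"
  proof (rule bilinear_eqI[of f ?p, OF assms lin_product_of_right lin_product_of_left])
    fix i j assume "i < n" "j < n"
    then show "f (e i) (e j) = ?p (e i) (e j)"
      by (intro coord_eqI) (simp add: coord_product_of_basis)
  qed
qed

text \<open>The coordinates of the associator on basis vectors are the values of the associativity
  polynomials at \<open>x\<close>; trilinearity extends the identity to all vectors.\<close>

lemma product_of_assoc:
  assumes "x \<in> Alg n"
  defines "\<mu> \<equiv> product_of scale e n x"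
  shows "\<mu> (\<mu> a b) c = \<mu> a (\<mu> b c)"
proof (rule trilinear_eqI[of "\<lambda>a b c. \<mu> (\<mu> a b) c" "\<lambda>a b c. \<mu> a (\<mu> b c)"])
  fix i j k assume ijk: "i < n" "j < n" "k < n"
  show "\<mu> (\<mu> (e i) (e j)) (e k) = \<mu> (e i) (\<mu> (e j) (e k))"
  proof (rule coord_eqI)
    fix m assume "m < n"
    then have "peval x (assoc_poly n i j k m) = 0" using assms(1) ijk by (simp add: Alg_iff)
    then show "cf (\<mu> (\<mu> (e i) (e j)) (e k)) m = cf (\<mu> (e i) (\<mu> (e j) (e k))) m"
      using ijk \<open>m < n\<close>
      by (simp add: \<mu>_def coord_product_of_basis_left coord_product_of_basis_right
          coord_basis if_distrib[of "\<lambda>a. a * _"] peval_assoc_poly mult.commute cong: if_cong)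
  qed
qed (simp_all add: \<mu>_def lin_iff product_of_add product_of_scale)

text \<open>On basis vectors, each coordinate of the cocycle expression \<open>t\<close> is minus
  the derivative of one associativity equation, and \<open>t\<close> is trilinear.\<close>

lemma cocycle_iff_dirderiv:
  fixes x d
  defines "\<mu> \<equiv> product_of scale e n x" and "f \<equiv> product_of scale e n d"
  shows "f \<in> hochschild_Z2 scale \<mu> \<longleftrightarrow>
    (\<forall>i<n. \<forall>j<n. \<forall>k<n. \<forall>m<n. dirderiv x d (assoc_poly n i j k m) = 0)" (is "_ \<longleftrightarrow> ?R")
proof -
  define t where "t a b c = \<mu> a (f b c) - f (\<mu> a b) c + f a (\<mu> b c) - \<mu> (f a b) c" for a b c
  have t_lin: "lin (t a b)" "lin (\<lambda>b. t a b c)" "lin (\<lambda>a. t a b c)" for a b c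
    by (simp_all add: t_def \<mu>_def f_def lin_iff product_of_add product_of_scale
        scale_right_distrib scale_right_diff_distrib)
  have coord_t: "cf (t (e i) (e j) (e k)) m = - dirderiv x d (assoc_poly n i j k m)"
    if "i < n" "j < n" "k < n" "m < n" for i j k m
    using that
    by (simp add: t_def \<mu>_def f_def coord_add coord_diff coord_product_of_basis_left
        coord_product_of_basis_right coord_basis if_distrib[of "\<lambda>a. a * _"]
        dirderiv_assoc_poly sum.distrib mult.commute cong: if_cong)
  have "f \<in> hochschild_Z2 scale \<mu> \<longleftrightarrow> (\<forall>a b c. t a b c = 0)"
    by (simp add: hochschild_Z2_def t_def f_def lin_product_of_left lin_product_of_right)
  also have "\<dots> \<longleftrightarrow> ?R"
  proof
    assume R: ?R
    have t_basis: "t (e i) (e j) (e k) = 0" if "i < n" "j < n" "k < n" for i j k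
      by (rule coord_eqI) (use R that in \<open>simp add: coord_t\<close>)
    have lin_0: "lin (\<lambda>_. 0)" by (simp add: lin_iff)
    show "\<forall>a b c. t a b c = 0"
      using trilinear_eqI[of t "\<lambda>_ _ _. 0", OF t_lin lin_0 lin_0 lin_0 t_basis] by simp
  next
    assume "\<forall>a b c. t a b c = 0"
    then show ?R using coord_t by (metis coord_zero neg_equal_0_iff_equal)
  qed
  finally show ?thesis .
qed

section \<open>The isomorphism from the tangent space to the cocycles\<close>

definition tangent_cocycle :: "(sc_var \<Rightarrow> 'k) \<Rightarrow> ('k sc_poly \<Rightarrow> 'k) \<Rightarrow> 'v \<Rightarrow> 'v \<Rightarrow> 'v" where
  "tangent_cocycle x \<phi> = product_of scale e n (\<lambda>v. \<phi> (pvar v - pconst (x v)))"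

lemma linear_tangent_cocycle:
  "Vector_Spaces.linear (scale1 (*)) (scale2 scale) (tangent_cocycle x)"
  unfolding Vector_Spaces.linear_iff
  by (simp add: vector_space_bimaps vector_space_scale1 vector_space_times tangent_cocycle_def
      product_of_def fun_eq_iff scale1_def scale2_def algebra_simps sum.distrib scale_sum_right)

text \<open>The polynomials \<open>pvar v - pconst (x v)\<close> are the local coordinates at
  \<open>x\<close>. The values of \<open>\<phi>\<close> on them form a direction that determines
  \<open>\<phi>\<close> as a directional derivative; conversely, the structure constants of a
  cocycle serve as a direction.\<close>

lemma bij_betw_tangent_cocycle:
  assumes x: "x \<in> Alg n"
  shows "bij_betw (tangent_cocycle x) (tangent_space n x)
    (hochschild_Z2 scale (product_of scale e n x))"
  unfolding bij_betw_def
proof (intro conjI equalityI subsetI inj_onI)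
  fix \<phi> \<psi> assume \<phi>: "\<phi> \<in> tangent_space n x" and \<psi>: "\<psi> \<in> tangent_space n x"
    and eq: "tangent_cocycle x \<phi> = tangent_cocycle x \<psi>"
  have gens: "\<phi> (pvar v - pconst (x v)) = \<psi> (pvar v - pconst (x v))" if v_in: "v \<in> sc_index n" for v
  proof -
    obtain i j l where v: "v = (i, j, l)" "i < n" "j < n" "l < n"
      using v_in by (cases v) (auto simp: sc_index_def)
    have "cf (tangent_cocycle x \<phi> (e i) (e j)) l = cf (tangent_cocycle x \<psi> (e i) (e j)) l"
      by (simp add: eq)
    then show ?thesis
      using v by (simp add: tangent_cocycle_def coord_product_of_basis)
  qed
  show "\<phi> = \<psi>"
  proof
    fix p
    show "\<phi> p = \<psi> p"
    proof (cases "p \<in> point_ideal n x")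
      case True
      then have p: "p \<in> sc_ring n" "peval x p = 0" by (simp_all add: point_ideal_mem)
      show ?thesis
        \<comment> \<open>Since \<open>p\<close> vanishes at \<open>x\<close>, both functionals at
          \<open>p\<close> are derivatives of \<open>p\<close> along directions that agree on
          \<open>sc_index n\<close>.\<close>
        using tangent_space_eq_dirderiv[OF \<phi> p(1)] tangent_space_eq_dirderiv[OF \<psi> p(1)]
          dirderiv_cong[OF p(1) gens] p(2)
        by (simp add: pconst_def)
    next
      case False
      then show ?thesis using \<phi> \<psi> by (simp add: tangent_space_def)
    qed
  qed
next
  fix f assume "f \<in> tangent_cocycle x ` tangent_space n x"
  then obtain \<phi> where \<phi>: "\<phi> \<in> tangent_space n x" and f: "f = tangent_cocycle x \<phi>" by auto
  have "dirderiv x (\<lambda>v. \<phi> (pvar v - pconst (x v))) (assoc_poly n i j k m) = 0"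
    if "i < n" "j < n" "k < n" "m < n" for i j k m
  proof -
    have "peval x (assoc_poly n i j k m) = 0" using x that by (simp add: Alg_iff)
    moreover have "\<phi> (assoc_poly n i j k m) = 0"
      using \<phi> assoc_poly_in_assoc_ideal[OF that] unfolding tangent_space_def by blast
    ultimately show ?thesis
      using tangent_space_eq_dirderiv[OF \<phi> assoc_poly_in_sc_ring[OF that]] by (simp add: pconst_def)
  qed
  then show "f \<in> hochschild_Z2 scale (product_of scale e n x)"
    by (simp add: f tangent_cocycle_def cocycle_iff_dirderiv)
next
  fix f assume f: "f \<in> hochschild_Z2 scale (product_of scale e n x)"
  define d where "d = (\<lambda>(i, j, l). cf (f (e i) (e j)) l)"
  have f_eq: "f = product_of scale e n d"
    unfolding d_def by (rule product_of_surj) (use f in \<open>simp_all add: hochschild_Z2_def\<close>)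
  define \<phi> where "\<phi> = (\<lambda>p. if p \<in> point_ideal n x then dirderiv x d p else 0)"
  have "\<phi> \<in> tangent_space n x"
    unfolding \<phi>_def using f cocycle_iff_dirderiv[of d x]
    by (intro dirderiv_in_tangent_space x) (simp add: f_eq)
  moreover have "tangent_cocycle x \<phi> = f"
    unfolding f_eq tangent_cocycle_def
    by (rule product_of_cong)
      (simp add: \<phi>_def point_ideal_mem sc_ring_diff peval_diff dirderiv_diff)
  ultimately show "f \<in> tangent_cocycle x ` tangent_space n x" by blast
qed

lemma dim_tangent_space:
  assumes "x \<in> Alg n"
  shows "vector_space.dim (scale1 (*)) (tangent_space n x) =
    vector_space.dim (scale2 scale) (hochschild_Z2 scale (product_of scale e n x))"
proof -
  have "vector_space.dim (scale2 scale) (tangent_cocycle x ` tangent_space n x) =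
      vector_space.dim (scale1 (*)) (tangent_space n x)"
    using bij_betw_tangent_cocycle[OF assms]
    by (intro dim_image_inj_on linear_tangent_cocycle subspace_tangent_space) (simp add: bij_betw_def)
  then show ?thesis
    using bij_betw_tangent_cocycle[OF assms] by (simp add: bij_betw_def)
qed

end

subsection \<open>Dimension formulas\<close>

lemma commutes_imp_scalar_mat:
  fixes Z :: "'a::comm_ring_1 mat"
  assumes Z: "Z \<in> carrier_mat r r" and r: "0 < r"
    and comm: "\<And>A. A \<in> carrier_mat r r \<Longrightarrow> Z * A = A * Z"
  shows "Z = Z $$ (0, 0) \<cdot>\<^sub>m 1\<^sub>m r"
proof (rule eq_matI)
  fix j l assume "j < dim_row (Z $$ (0, 0) \<cdot>\<^sub>m 1\<^sub>m r)" "l < dim_col (Z $$ (0, 0) \<cdot>\<^sub>m 1\<^sub>m r)"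
  then have jl: "j < r" "l < r" by auto
  \<comment> \<open>The matrix unit with its 1 at position (0, j): row 0 of \<open>E * Z\<close> is
    row j of \<open>Z\<close>, while row 0 of \<open>Z * E\<close> has only the entry
    \<open>Z $$ (0, 0)\<close>, in column j.\<close>
  define E where "E = mat r r (\<lambda>(a, b). if a = 0 \<and> b = j then 1 else 0 :: 'a)"
  have E: "E \<in> carrier_mat r r" by (simp add: E_def)
  have if_conj: "(if P \<and> Q then a else 0) = (if P then if Q then a else 0 else 0)"
    for P Q and a :: 'a by simp
  have "(Z * E) $$ (0, l) = (if l = j then Z $$ (0, 0) else 0)"
    using Z r jl
    by (simp add: E_def scalar_prod_def if_distrib[of "(*) _"] if_conj cong: if_cong)
  moreover have "(E * Z) $$ (0, l) = Z $$ (j, l)"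
    using Z r jl
    by (simp add: E_def scalar_prod_def if_distrib[of "\<lambda>a. a * _"] cong: if_cong)
  ultimately show "Z $$ (j, l) = (Z $$ (0, 0) \<cdot>\<^sub>m 1\<^sub>m r) $$ (j, l)"
    using jl comm[OF E] by auto
qed (use Z in auto)

context based_algebra
begin

lemma linear_coboundary: "Vector_Spaces.linear (scale1 scale) (scale2 scale) coboundary"
  unfolding Vector_Spaces.linear_iff
  by (simp add: vector_space_maps vector_space_bimaps coboundary_def fun_eq_iff scale1_def scale2_def
      mult_add_left mult_add_right mult_scale_left mult_scale_right scale_right_distrib
      scale_right_diff_distrib)

lemma linear_inner: "Vector_Spaces.linear scale (scale1 scale) inner"
  unfolding Vector_Spaces.linear_iff
  by (simp add: vector_space_axioms vector_space_maps inner_def fun_eq_iff scale1_def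
      mult_add_left mult_add_right mult_scale_left mult_scale_right scale_right_diff_distrib)

text \<open>Rank-nullity for \<open>coboundary\<close> on the endomorphisms, with kernel
  \<open>Der\<close> and image \<open>Z2\<close>.\<close>

lemma dim_Der_add_dim_Z2:
  "vector_space.dim (scale1 scale) Der + vector_space.dim (scale2 scale) Z2 = n * n"
  using dim_kernel_add_dim_image[OF linear_coboundary subspace_lin _ subsetI[OF lin_in_span]]
  by (simp add: dim_lin coboundary_kernel Z2_eq_coboundaries)

text \<open>Rank-nullity for \<open>inner\<close> on V, with kernel the centre and image
  \<open>Der\<close>.\<close>

lemma dim_centre_add_dim_Der: "dim (centre mult) + vector_space.dim (scale1 scale) Der = n"
  using dim_kernel_add_dim_image[OF linear_inner, of UNIV "e ` {..<n}"]
  by (simp add: dim_UNIV inner_kernel Der_eq_inner span_basis)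

lemma subspace_centre: "subspace (centre mult)"
  by (simp add: subspace_def centre_def mult_add_left mult_add_right mult_scale_left mult_scale_right
      endo.linear_0[OF lin_mult_left] endo.linear_0[OF lin_mult_right])

text \<open>An element is central exactly when each of its blocks is a scalar matrix, and the
  \<open>k\<close> scalars can be chosen freely.\<close>

lemma dim_centre_matrix_sum:
  assumes iso: "iso_matrix_sum scale mult k r" and r: "\<forall>s<k. 1 \<le> r s"
  shows "dim (centre mult) = k"
proof -
  obtain F :: "'v \<Rightarrow> nat \<Rightarrow> 'k mat" where
    bij: "bij_betw F UNIV (\<Pi>\<^sub>E s\<in>{..<k}. carrier_mat (r s) (r s))"
    and F_add: "\<And>a b s. s < k \<Longrightarrow> F (a + b) s = F a s + F b s"
    and F_scale: "\<And>c a s. s < k \<Longrightarrow> F (scale c a) s = c \<cdot>\<^sub>m F a s"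
    and F_mult: "\<And>a b s. s < k \<Longrightarrow> F (a ** b) s = F a s * F b s"
    using iso unfolding iso_matrix_sum_def by blast
  have F_PiE: "F a \<in> (\<Pi>\<^sub>E s\<in>{..<k}. carrier_mat (r s) (r s))" for a
    using bij_betwE[OF bij] by simp
  then have F_carrier: "F a s \<in> carrier_mat (r s) (r s)" if "s < k" for a s
    using that by (auto simp: PiE_iff)
  have F_eqI: "a = b" if "\<And>s. s < k \<Longrightarrow> F a s = F b s" for a b
  proof -
    have "F a = F b" using F_PiE[of a] F_PiE[of b] that by (intro PiE_ext) auto
    then show ?thesis using bij by (auto simp: bij_betw_def inj_def)
  qed
  have F_surj: "\<exists>a. \<forall>s<k. F a s = A s" if "\<And>s. s < k \<Longrightarrow> A s \<in> carrier_mat (r s) (r s)" for A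
  proof -
    have "restrict A {..<k} \<in> F ` UNIV"
      using bij that by (simp add: bij_betw_def)
    then obtain a where "F a = restrict A {..<k}" by auto
    then show ?thesis by (intro exI[of _ a]) simp
  qed
  \<comment> \<open>The scalar of a block is read off at entry (0, 0), which exists because every
    block has size at least 1; the value 0 beyond \<open>k\<close> fits
    \<open>dim_functions_supported_on\<close>.\<close>
  define \<chi> where "\<chi> z = (\<lambda>s. if s < k then F z s $$ (0, 0) else 0)" for z
  have scalar: "F z s = \<chi> z s \<cdot>\<^sub>m 1\<^sub>m (r s)" if z: "z \<in> centre mult" and s: "s < k" for z s
  proof -
    have "F z s * A = A * F z s" if A: "A \<in> carrier_mat (r s) (r s)" for A
    proof -
      \<comment> \<open>An arbitrary matrix in block \<open>s\<close>, padded by zero blocks, comes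
        from an algebra element, with which \<open>z\<close> commutes.\<close>
      have "\<exists>a. \<forall>s'<k. F a s' = (if s' = s then A else 0\<^sub>m (r s') (r s'))"
        by (rule F_surj) (use A in auto)
      then obtain a where "\<forall>s'<k. F a s' = (if s' = s then A else 0\<^sub>m (r s') (r s'))" ..
      then have "F a s = A" using s by simp
      moreover have "F (z ** a) s = F (a ** z) s" using z by (simp add: centre_def)
      ultimately show ?thesis using s by (simp add: F_mult)
    qed
    then have "F z s = F z s $$ (0, 0) \<cdot>\<^sub>m 1\<^sub>m (r s)"
      using F_carrier[OF s] r s by (intro commutes_imp_scalar_mat) auto
    then show ?thesis using s by (simp add: \<chi>_def)
  qed
  have "Vector_Spaces.linear scale (scale1 (*)) \<chi>"
    unfolding Vector_Spaces.linear_iff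
  proof (intro conjI allI)
    fix a b c
    have "dim_row (F b s) = r s" "dim_col (F b s) = r s" "0 < r s" if "s < k" for b s
      using that r F_carrier[OF that, of b] by auto
    then show "\<chi> (a + b) = \<chi> a + \<chi> b" "\<chi> (scale c a) = scale1 (*) c (\<chi> a)"
      by (auto simp: \<chi>_def fun_eq_iff scale1_def F_add F_scale)
  qed (simp_all add: vector_space_axioms vector_space_scale1 vector_space_times)
  moreover have "inj_on \<chi> (centre mult)"
    by (rule inj_onI, rule F_eqI) (simp add: scalar)
  moreover have "\<chi> ` centre mult = {c. \<forall>s. s \<notin> {..<k} \<longrightarrow> c s = 0}"
  proof (intro equalityI subsetI)
    fix c :: "nat \<Rightarrow> 'k" assume c: "c \<in> {c. \<forall>s. s \<notin> {..<k} \<longrightarrow> c s = 0}"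
    have "\<exists>z. \<forall>s<k. F z s = c s \<cdot>\<^sub>m 1\<^sub>m (r s)"
      by (rule F_surj) simp
    then obtain z where z: "\<forall>s<k. F z s = c s \<cdot>\<^sub>m 1\<^sub>m (r s)" ..
    have "z ** a = a ** z" for a
    proof (rule F_eqI)
      fix s assume s: "s < k"
      have "F a s \<in> carrier_mat (r s) (r s)" using F_carrier s by blast
      then show "F (z ** a) s = F (a ** z) s"
        using s z by (simp add: F_mult mult_smult_assoc_mat[of _ "r s" "r s" _ "r s"]
            mult_smult_distrib[of _ "r s" "r s" _ "r s"])
    qed
    then have "z \<in> centre mult" by (simp add: centre_def)
    moreover have "\<chi> z = c"
      using z c r by (auto simp: \<chi>_def fun_eq_iff)
    ultimately show "c \<in> \<chi> ` centre mult" by blast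
  qed (auto simp: \<chi>_def)
  ultimately show ?thesis
    using dim_image_inj_on[OF _ subspace_centre, of "scale1 (*)" \<chi>]
      dim_functions_supported_on[of "{..<k}", where ?'k = 'k] by simp
qed

end

theorem theorem1p6:
  fixes scale :: "'k::field_char_0 \<Rightarrow> 'v::ab_group_add \<Rightarrow> 'v"
    and e :: "nat \<Rightarrow> 'v" and n :: nat
    and x :: "sc_var \<Rightarrow> 'k" and \<mu> :: "'v \<Rightarrow> 'v \<Rightarrow> 'v"
  assumes "vector_space scale"
    and "indexed_basis scale e n"
    and "x \<in> separable_locus scale e n"
    and "\<mu> = product_of scale e n x"
  shows "lin_isomorphic (scale1 (*)) (tangent_space n x)
           (scale2 scale) (hochschild_Z2 scale \<mu>)
     \<and> int (vector_space.dim (scale1 (*)) (tangent_space n x))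
         = int n ^ 2 - int (vector_space.dim (scale1 scale) (derivations scale \<mu>))
     \<and> int n ^ 2 - int (vector_space.dim (scale1 scale) (derivations scale \<mu>))
         = int n ^ 2 - int n + int (vector_space.dim scale (centre \<mu>))
     \<and> (algebraically_closed_field TYPE('k) \<longrightarrow>
         (\<forall>k r. (\<forall>s<k. 1 \<le> r s) \<longrightarrow> (\<Sum>s<k. (r s) ^ 2) = n \<longrightarrow> iso_matrix_sum scale \<mu> k r \<longrightarrow>
           int (vector_space.dim (scale1 (*)) (tangent_space n x)) = int n ^ 2 - int n + int k))"
proof -
  interpret based_space scale e n
    by (intro based_space.intro based_space_axioms.intro assms)
  have x: "x \<in> Alg n" and discr: "discr scale e n x \<noteq> 0"
    using assms(3) by (simp_all add: separable_locus_def)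
  interpret based_algebra scale e n \<mu>
  proof
    show "det (mat n n (\<lambda>(i, j). tr (\<lambda>c. \<mu> (\<mu> (e i) (e j)) c))) \<noteq> 0"
      using discr by (simp add: discr_def assms(4) Let_def)
  qed (simp_all add: assms(4) lin_product_of_left lin_product_of_right
      product_of_add product_of_scale product_of_assoc x)
  have iso: "lin_isomorphic (scale1 (*)) (tangent_space n x) (scale2 scale) (hochschild_Z2 scale \<mu>)"
    unfolding lin_isomorphic_def
    using bij_betw_tangent_cocycle[OF x] linear_tangent_cocycle[of x]
    by (intro exI[of _ "tangent_cocycle x"]) (simp add: assms(4) Vector_Spaces.linear_iff)
  \<comment> \<open>The identity is first stated as a sum of natural numbers and then moved to the
    integers, where subtraction is not truncated.\<close>
  have "vector_space.dim (scale1 (*)) (tangent_space n x) + vector_space.dim (scale1 scale) Der = n * n"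
    using dim_Der_add_dim_Z2 dim_tangent_space[OF x] by (simp add: assms(4))
  then have T: "int (vector_space.dim (scale1 (*)) (tangent_space n x)) =
      int n ^ 2 - int (vector_space.dim (scale1 scale) Der)"
    by (simp add: power2_eq_square flip: of_nat_mult of_nat_add)
  moreover have Z: "int n = int (dim (centre \<mu>)) + int (vector_space.dim (scale1 scale) Der)"
    by (simp add: dim_centre_add_dim_Der flip: of_nat_add)
  ultimately show ?thesis
    using iso dim_centre_matrix_sum by auto
qed

end
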